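(* Let $Q=\{(x,y,z)\in\mathbb{R}^3: x^2/a+y^2/b+z^2/c=1\}$ with $a>b>c>0$. There exist periodic billiard trajectories inside $Q$ with elliptic period $m=4$, signature $\tau=(0,0,1)$, and caustic type H1H1 if and only if $$c<\frac{ab}{a+b}.$$ Besides, the caustic parameters $\lambda_1$ and $\lambda_2$ of such periodic billiard trajectories are the roots of the quadratic polynomial $\frac{s_1^2-s_2}{2}t^2-s_1t+1$, where $$s_l=\frac{1}{a^l}+\frac{1}{b^l}+\frac{1}{c^l}-\frac{2}{d^l},\qquad l=1,2,$$ and $d$ is the only root of the cubic polynomial $t^3-2(a+b+c)t^2+3(ab+ac+bc)t-4abc$ in the interval $(a,+\infty)$.
   Context: Confocal quadrics: $Q_\lambda=\{x^2/(a-\lambda)+y^2/(b-\lambda)+z^2/(c-\lambda)=1\}$. The lines containing the segments of a billiard trajectory inside $Q$ are all tangent to the same two confocal quadrics $Q_{\lambda_1},Q_{\lambda_2}$ (caustics; $\lambda_1,\lambda_2$ are the caustic parameters). The trajectory is nonsingular if $\lambda_1\ne\lambda_2$ and $\lambda_1,\lambda_2\notin\{a,b,c\}$; we order $\lambda_1<\lambda_2$. It has caustic type H1H1 if $c<\lambda_1<\lambda_2<b$ (both caustics are one-sheet hyperboloids). Jacobi elliptic coordinates: a generic point lies on exactly three quadrics $Q_{\mu_0},Q_{\mu_1},Q_{\mu_2}$ with $\mu_0<c<\mu_1<b<\mu_2<a$; $(\mu_0,\mu_1,\mu_2)$ are its elliptic coordinates (extended by continuity to all points). Let $\{c_1,\ldots,c_5\}=\{a,b,c,\lambda_1,\lambda_2\}$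 with $c_0:=0<c_1<\cdots<c_5$. Along a nonsingular trajectory, $\mu_j$ oscillates in $[c_{2j},c_{2j+1}]$, $j=0,1,2$. If the trajectory is periodic, its period $m_0$ is the least number of bounces after which it closes, and its winding numbers $m_0,m_1,m_2$ are the numbers of complete oscillations of $\mu_j$ in $[c_{2j},c_{2j+1}]$ along one period (so the $0$-th is the period). One has $\gcd(m_0,m_1,m_2)\in\{1,2\}$, and the elliptic period is $m=m_0/\gcd(m_0,m_1,m_2)$, i.e. the number of bounces after which the trajectory closes in elliptic coordinates. All nonsingular trajectories sharing the same caustics have the same periodicity, period and winding numbers. Signature: put $\gamma_i=1/c_i$ ($i=1,\ldots,5$), $\gamma_6=0$, and $R(x)=x\prod_{i=1}^5(x-\gamma_i)$. Nonsingular trajectories with elliptic period $m$ and caustics $Q_{\lambda_1},Q_{\lambda_2}$ have signature $\tau=(\tau_1,\tau_2,\tau_3)$ (non-negative integers with $\tau_1+\tau_2+\tau_3=m-3$) if condition $\mathcal{C}(m,3;\tau)$ holds: there exist monic polynomials $S(x),P(x)\in\mathbb{R}[x]$ with $\deg S=m-3$, $\deg P=m$, $P(0)\neq0$, $S^2(x)R(x)=P(x)(P(x)-P(0))$, such that $S$ has $m-3$ simple real roots, exactly $\tau_r$ of which lie in $(\gamma_{2r},\gamma_{2r-1})$ for $r=1,2,3$. *)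

theory Defs
  imports "HOL-Analysis.Analysis" "HOL-Computational_Algebra.Polynomial"
begin

text \<open>
  The ellipsoid is the member \<open>l = 0\<close> of the confocal family \<open>confocal_quadric a b c l\<close>, which is
  only meaningful for \<open>l \<notin> {a, b, c}\<close>.
\<close>

definition confocal_form :: "real \<Rightarrow> real \<Rightarrow> real \<Rightarrow> real \<Rightarrow> real^3 \<Rightarrow> real^3 \<Rightarrow> real" where
  "confocal_form a b c l u v =
     u$1 * v$1 / (a - l) + u$2 * v$2 / (b - l) + u$3 * v$3 / (c - l)"

definition confocal_quadric :: "real \<Rightarrow> real \<Rightarrow> real \<Rightarrow> real \<Rightarrow> (real^3) set" where
  "confocal_quadric a b c l = {p. confocal_form a b c l p p = 1}"

definition ellipsoid :: "real \<Rightarrow> real \<Rightarrow> real \<Rightarrow> (real^3) set" where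
  "ellipsoid a b c = {p. (p$1)^2 / a + (p$2)^2 / b + (p$3)^2 / c = 1}"

definition ellipsoid_normal :: "real \<Rightarrow> real \<Rightarrow> real \<Rightarrow> real^3 \<Rightarrow> real^3" where
  "ellipsoid_normal a b c p = vector [p$1 / a, p$2 / b, p$3 / c]"

definition reflect :: "real^3 \<Rightarrow> real^3 \<Rightarrow> real^3" where
  "reflect n u = u - (2 * (u \<bullet> n) / (n \<bullet> n)) *\<^sub>R n"


subsection \<open>Billiard trajectories\<close>

text \<open>A trajectory is given by its bi-infinite sequence of impact points.\<close>

definition chord_direction :: "(int \<Rightarrow> real^3) \<Rightarrow> int \<Rightarrow> real^3" where
  "chord_direction q k = sgn (q (k + 1) - q k)"

definition billiard_trajectory :: "real \<Rightarrow> real \<Rightarrow> real \<Rightarrow> (int \<Rightarrow> real^3) \<Rightarrow> bool" where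
  "billiard_trajectory a b c q \<longleftrightarrow>
     (\<forall>k. q k \<in> ellipsoid a b c \<and> q (k + 1) \<noteq> q k \<and>
          chord_direction q k
            = reflect (ellipsoid_normal a b c (q k)) (chord_direction q (k - 1)))"

text \<open>The moving point, with \<open>[k, k + 1]\<close> parametrizing the \<open>k\<close>-th segment affinely.\<close>

definition trajectory_path :: "(int \<Rightarrow> real^3) \<Rightarrow> real \<Rightarrow> real^3" where
  "trajectory_path q t = (1 - frac t) *\<^sub>R q \<lfloor>t\<rfloor> + frac t *\<^sub>R q (\<lfloor>t\<rfloor> + 1)"

definition periodic_trajectory :: "(int \<Rightarrow> real^3) \<Rightarrow> bool" where
  "periodic_trajectory q \<longleftrightarrow> (\<exists>n::nat. n > 0 \<and> (\<forall>k. q (k + int n) = q k))"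

definition trajectory_period :: "(int \<Rightarrow> real^3) \<Rightarrow> nat" where
  "trajectory_period q = (LEAST n::nat. n > 0 \<and> (\<forall>k. q (k + int n) = q k))"


subsection \<open>Caustics\<close>

text \<open>
  Tangency of the line through \<open>p\<close> with direction \<open>v\<close>, either at a point of the quadric (whose normal
  is orthogonal to \<open>v\<close>) or at the point at infinity of the line.  The second case occurs for lines
  in an asymptotic plane of a hyperboloid; it has to be allowed, since segments of a
  trajectory with a hyperboloid as caustic can lie on such lines.
\<close>

definition line_tangent_to_quadric ::
    "real \<Rightarrow> real \<Rightarrow> real \<Rightarrow> real \<Rightarrow> real^3 \<Rightarrow> real^3 \<Rightarrow> bool" where
  "line_tangent_to_quadric a b c l p v \<longleftrightarrow>
     (\<exists>t. p + t *\<^sub>R v \<in> confocal_quadric a b c l \<and> confocal_form a b c l (p + t *\<^sub>R v) v = 0)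
   \<or> (confocal_form a b c l v v = 0 \<and> confocal_form a b c l p v = 0)"

definition nonsingular_with_caustics ::
    "real \<Rightarrow> real \<Rightarrow> real \<Rightarrow> (int \<Rightarrow> real^3) \<Rightarrow> real \<Rightarrow> real \<Rightarrow> bool" where
  "nonsingular_with_caustics a b c q l1 l2 \<longleftrightarrow>
     l1 < l2 \<and> l1 \<notin> {a, b, c} \<and> l2 \<notin> {a, b, c} \<and>
     (\<forall>k. line_tangent_to_quadric a b c l1 (q k) (q (k + 1) - q k) \<and>
          line_tangent_to_quadric a b c l2 (q k) (q (k + 1) - q k))"

definition caustic_type_H1H1 :: "real \<Rightarrow> real \<Rightarrow> real \<Rightarrow> real \<Rightarrow> real \<Rightarrow> bool" where
  "caustic_type_H1H1 a b c l1 l2 \<longleftrightarrow> c < l1 \<and> l1 < l2 \<and> l2 < b"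


subsection \<open>Elliptic coordinates\<close>

text \<open>The coordinates of a point are the values of \<open>m\<close> at 0, 1 and 2.\<close>

definition generic_elliptic_coords ::
    "real \<Rightarrow> real \<Rightarrow> real \<Rightarrow> real^3 \<Rightarrow> (nat \<Rightarrow> real) \<Rightarrow> bool" where
  "generic_elliptic_coords a b c p m \<longleftrightarrow>
     m 0 < c \<and> c < m 1 \<and> m 1 < b \<and> b < m 2 \<and> m 2 < a \<and>
     {l. l \<notin> {a, b, c} \<and> p \<in> confocal_quadric a b c l} = {m 0, m 1, m 2}"

definition generic_points :: "real \<Rightarrow> real \<Rightarrow> real \<Rightarrow> (real^3) set" where
  "generic_points a b c = {p. \<exists>m. generic_elliptic_coords a b c p m}"

text \<open>Extension by continuity from the (dense) set of generic points.\<close>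

definition elliptic_coord :: "real \<Rightarrow> real \<Rightarrow> real \<Rightarrow> nat \<Rightarrow> real^3 \<Rightarrow> real" where
  "elliptic_coord a b c j p =
     Lim (at p within generic_points a b c)
         (\<lambda>x. THE y. \<exists>m. generic_elliptic_coords a b c x m \<and> y = m j)"


subsection \<open>Winding numbers and elliptic period\<close>

text \<open>\<open>cseq a b c l1 l2 ! i\<close> is \<open>c\<^sub>i\<close> for \<open>i = 0, \<dots>, 5\<close>.\<close>

definition cseq :: "real \<Rightarrow> real \<Rightarrow> real \<Rightarrow> real \<Rightarrow> real \<Rightarrow> real list" where
  "cseq a b c l1 l2 = 0 # sorted_list_of_set {a, b, c, l1, l2}"

text \<open>
  An oscillation of \<open>f\<close> in \<open>[lo, hi]\<close> starts at the value \<open>lo\<close> and is complete when \<open>lo\<close> is attained for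
  the next time, provided \<open>hi\<close> has been attained in between.  Oscillations of the \<open>T\<close>-periodic \<open>f\<close>
  are counted by their starting times in \<open>[0, T)\<close>.
\<close>

definition complete_oscillations :: "(real \<Rightarrow> real) \<Rightarrow> real \<Rightarrow> real \<Rightarrow> real \<Rightarrow> nat" where
  "complete_oscillations f lo hi T =
     card {s. 0 \<le> s \<and> s < T \<and> f s = lo \<and>
              (\<exists>t>s. f t = lo \<and> (\<forall>u. s < u \<and> u < t \<longrightarrow> f u \<noteq> lo) \<and>
                     (\<exists>u. s < u \<and> u < t \<and> f u = hi))}"

definition winding_number_at ::
    "real \<Rightarrow> real \<Rightarrow> real \<Rightarrow> real \<Rightarrow> real \<Rightarrow> (int \<Rightarrow> real^3) \<Rightarrow> nat \<Rightarrow> nat" where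
  "winding_number_at a b c l1 l2 q j =
     (if j = 0 then trajectory_period q
      else complete_oscillations (\<lambda>t. elliptic_coord a b c j (trajectory_path q t))
             (cseq a b c l1 l2 ! (2 * j)) (cseq a b c l1 l2 ! (2 * j + 1))
             (real (trajectory_period q)))"

definition elliptic_period ::
    "real \<Rightarrow> real \<Rightarrow> real \<Rightarrow> real \<Rightarrow> real \<Rightarrow> (int \<Rightarrow> real^3) \<Rightarrow> nat" where
  "elliptic_period a b c l1 l2 q =
     winding_number_at a b c l1 l2 q 0 div
     Gcd {winding_number_at a b c l1 l2 q 0,
          winding_number_at a b c l1 l2 q 1,
          winding_number_at a b c l1 l2 q 2}"


subsection \<open>Signature\<close>

definition gamma_seq :: "real \<Rightarrow> real \<Rightarrow> real \<Rightarrow> real \<Rightarrow> real \<Rightarrow> nat \<Rightarrow> real" where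
  "gamma_seq a b c l1 l2 i = (if i = 6 then 0 else 1 / cseq a b c l1 l2 ! i)"

definition R_poly :: "real \<Rightarrow> real \<Rightarrow> real \<Rightarrow> real \<Rightarrow> real \<Rightarrow> real poly" where
  "R_poly a b c l1 l2 = [:0, 1:] * (\<Prod>i=1..5. [:- gamma_seq a b c l1 l2 i, 1:])"

text \<open>The condition \<open>C(m,3;\<tau>)\<close>; the signature \<open>(\<tau>\<^sub>1, \<tau>\<^sub>2, \<tau>\<^sub>3)\<close> is a list, so \<open>\<tau>\<^sub>r\<close> is \<open>\<tau> ! (r - 1)\<close>.\<close>

definition has_signature ::
    "real \<Rightarrow> real \<Rightarrow> real \<Rightarrow> real \<Rightarrow> real \<Rightarrow> nat \<Rightarrow> nat list \<Rightarrow> bool" where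
  "has_signature a b c l1 l2 m \<tau> \<longleftrightarrow>
     length \<tau> = 3 \<and> sum_list \<tau> + 3 = m \<and>
     (\<exists>S P :: real poly.
        lead_coeff S = 1 \<and> lead_coeff P = 1 \<and> degree S = m - 3 \<and> degree P = m \<and>
        poly P 0 \<noteq> 0 \<and> S^2 * R_poly a b c l1 l2 = P * (P - [:poly P 0:]) \<and>
        card {x. order x S = 1} = m - 3 \<and>
        (\<forall>r\<in>{1, 2, 3}.
           card {x. poly S x = 0 \<and> gamma_seq a b c l1 l2 (2 * r) < x \<and>
                    x < gamma_seq a b c l1 l2 (2 * r - 1)} = \<tau> ! (r - 1)))"

definition periodic_H1H1_trajectory ::
    "real \<Rightarrow> real \<Rightarrow> real \<Rightarrow> nat \<Rightarrow> nat list \<Rightarrow> (int \<Rightarrow> real^3) \<Rightarrow> real \<Rightarrow> real \<Rightarrow> bool" where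
  "periodic_H1H1_trajectory a b c m \<tau> q l1 l2 \<longleftrightarrow>
     billiard_trajectory a b c q \<and> periodic_trajectory q \<and>
     nonsingular_with_caustics a b c q l1 l2 \<and> caustic_type_H1H1 a b c l1 l2 \<and>
     elliptic_period a b c l1 l2 q = m \<and> has_signature a b c l1 l2 m \<tau>"

end

theory Submission
  imports Defs
begin

text \<open>
  Write \<open>\<alpha> = 1 / a\<close>, \<open>\<beta> = 1 / b\<close>, \<open>\<kappa> = 1 / c\<close>, \<open>\<sigma> = 1 / d\<close>, \<open>l = 1 / \<lambda>\<^sub>1\<close>, \<open>m = 1 / \<lambda>\<^sub>2\<close>.  Counting the zeros of
  \<open>P'\<close> shows that signature \<open>(0, 0, 1)\<close> forces \<open>P = (x - \<sigma>)\<^sup>2 (x - l) (x - m)\<close> and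
  \<open>P - P 0 = x (x - \<alpha>) (x - \<beta>) (x - \<kappa>)\<close>.  So \<open>\<sigma>\<close> is the critical point of this quartic in \<open>(0, \<alpha>)\<close>, and \<open>l \<noteq> m\<close>
  are real exactly when the other local minimum of the quartic is deeper, i.e. when \<open>\<kappa> > \<alpha> + \<beta>\<close>.

  Conversely, such \<open>\<sigma>, l, m\<close> yield an explicit trajectory of period 4 that is symmetric about the
  \<open>x\<close>-axis: its first chord crosses the axis in a vertex of the caustic \<open>\<lambda>\<^sub>1\<close> and touches the caustic \<open>\<lambda>\<^sub>2\<close> at
  infinity, and the opposite chord does the same with the caustics exchanged.  The two caustics
  are touched alternately, three times each, so the winding numbers \<open>m\<^sub>0 = 4\<close> and \<open>m\<^sub>1 = 3\<close> are coprime.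
\<close>

section \<open>Reflections and confocal quadrics\<close>

lemma ellipsoid_normal_nth [simp]:
  "ellipsoid_normal a b c p $ 1 = p $ 1 / a"
  "ellipsoid_normal a b c p $ 2 = p $ 2 / b"
  "ellipsoid_normal a b c p $ 3 = p $ 3 / c"
  by (simp_all add: ellipsoid_normal_def)

lemma inner_vec3:
  fixes u v :: "real^3"
  shows "u \<bullet> v = u$1 * v$1 + u$2 * v$2 + u$3 * v$3"
  by (simp add: inner_vec_def sum_3)

lemma confocal_form_bilinear:
  "confocal_form a b c l (x + y) z = confocal_form a b c l x z + confocal_form a b c l y z"
  "confocal_form a b c l (x - y) z = confocal_form a b c l x z - confocal_form a b c l y z"
  "confocal_form a b c l (t *\<^sub>R x) z = t * confocal_form a b c l x z"
  "confocal_form a b c l z (x + y) = confocal_form a b c l z x + confocal_form a b c l z y"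
  "confocal_form a b c l z (x - y) = confocal_form a b c l z x - confocal_form a b c l z y"
  "confocal_form a b c l z (t *\<^sub>R x) = t * confocal_form a b c l z x"
  "confocal_form a b c l z (- x) = - confocal_form a b c l z x"
  "confocal_form a b c l (- x) z = - confocal_form a b c l x z"
  by (simp_all add: confocal_form_def algebra_simps add_divide_distrib diff_divide_distrib)

lemma confocal_form_commute: "confocal_form a b c l x y = confocal_form a b c l y x"
  by (simp add: confocal_form_def mult.commute)

text \<open>Reversing a chord replaces the parameter \<open>t\<close> of its contact point by
  \<open>1 - t\<close>, and a contact at infinity stays there. The symmetry exchanging the two
  caustics reverses the chords between the two halves of the orbit, so both directions
  occur.\<close>

lemma line_tangent_reverse:
  assumes "line_tangent_to_quadric a b c l x (y - x)"
  shows "line_tangent_to_quadric a b c l y (x - y)"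
  using assms unfolding line_tangent_to_quadric_def
proof (elim disjE exE conjE)
  fix t assume "x + t *\<^sub>R (y - x) \<in> confocal_quadric a b c l"
    "confocal_form a b c l (x + t *\<^sub>R (y - x)) (y - x) = 0"
  moreover have "x + t *\<^sub>R (y - x) = y + (1 - t) *\<^sub>R (x - y)" by (simp add: algebra_simps)
  ultimately show "(\<exists>t. y + t *\<^sub>R (x - y) \<in> confocal_quadric a b c l \<and>
      confocal_form a b c l (y + t *\<^sub>R (x - y)) (x - y) = 0) \<or>
    confocal_form a b c l (x - y) (x - y) = 0 \<and> confocal_form a b c l y (x - y) = 0"
    by (intro disjI1 exI[of _ "1 - t"]) (simp add: confocal_form_bilinear)
next
  assume "confocal_form a b c l (y - x) (y - x) = 0" "confocal_form a b c l x (y - x) = 0"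
  then show "(\<exists>t. y + t *\<^sub>R (x - y) \<in> confocal_quadric a b c l \<and>
      confocal_form a b c l (y + t *\<^sub>R (x - y)) (x - y) = 0) \<or>
    confocal_form a b c l (x - y) (x - y) = 0 \<and> confocal_form a b c l y (x - y) = 0"
    by (intro disjI2) (simp add: confocal_form_bilinear)
qed

lemma reflect_scaleR: "reflect n (t *\<^sub>R u) = t *\<^sub>R reflect n u"
  by (simp add: reflect_def algebra_simps)

lemma reflect_minus: "reflect n (- u) = - reflect n u"
  using reflect_scaleR[of n "-1" u] by simp

lemma reflect_reflect: "reflect n (reflect n u) = u"
  by (cases "n = 0") (simp_all add: reflect_def algebra_simps)

lemma norm_reflect: "norm (reflect n u) = norm u"
proof (cases "n = 0")
  case False
  then have "reflect n u \<bullet> reflect n u = u \<bullet> u"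
    by (simp add: reflect_def inner_diff_left inner_diff_right inner_commute[of n u] field_simps)
  then show ?thesis by (simp add: norm_eq_sqrt_inner)
qed (simp add: reflect_def)

lemma sgn_reflect: "sgn (reflect n u) = reflect n (sgn u)"
  by (simp add: sgn_div_norm norm_reflect reflect_scaleR)

text \<open>The second equation is the same corner run through backwards, since reflection is an
  involution. One computation thus covers the corners entered by a short chord and those left by
  one.\<close>

lemma reflection_law:
  fixes x y z :: "real^3"
  assumes "z - y = t *\<^sub>R reflect n (y - x)" "t > 0"
  shows "sgn (z - y) = reflect n (sgn (y - x))" "sgn (x - y) = reflect n (sgn (y - z))"
proof -
  show *: "sgn (z - y) = reflect n (sgn (y - x))"
    using assms by (simp add: sgn_scaleR sgn_reflect)
  then have "reflect n (sgn (z - y)) = sgn (y - x)" by (simp add: reflect_reflect)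
  then have "reflect n (- sgn (z - y)) = - sgn (y - x)" by (simp add: reflect_minus)
  then show "sgn (x - y) = reflect n (sgn (y - z))"
    by (simp add: sgn_minus[symmetric])
qed

lemma trajectory_path_segment:
  assumes "0 \<le> t" "t < 1"
  shows "trajectory_path q (real_of_int k + t) = (1 - t) *\<^sub>R q k + t *\<^sub>R q (k + 1)"
proof -
  have "\<lfloor>real_of_int k + t\<rfloor> = k" using assms by (simp add: floor_eq_iff)
  moreover from this have "frac (real_of_int k + t) = t" by (simp add: frac_def)
  ultimately show ?thesis by (simp add: trajectory_path_def)
qed

section \<open>The middle elliptic coordinate\<close>

abbreviation confocal_excess :: "real \<Rightarrow> real \<Rightarrow> real \<Rightarrow> real^3 \<Rightarrow> real \<Rightarrow> real" where
  "confocal_excess a b c p l \<equiv> confocal_form a b c l p p - 1"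

text \<open>Each term \<open>x^2 / (h - l)\<close> increases with \<open>l\<close> on an interval
  avoiding its pole \<open>h\<close>, and \<open>(c, b)\<close> avoids all three poles.\<close>

lemma confocal_excess_strict_mono:
  assumes "b < a" "c < l" "l < l'" "l' < b" "p \<noteq> 0"
  shows "confocal_excess a b c p l < confocal_excess a b c p l'"
proof -
  have *: "x^2 / (h - l) \<le> x^2 / (h - l')" and **: "x \<noteq> 0 \<Longrightarrow> x^2 / (h - l) < x^2 / (h - l')"
    if "h < l \<or> l' < h" for x h :: real
  proof -
    have "1 / (h - l) < 1 / (h - l')"
      using that \<open>l < l'\<close> by (auto simp: divide_simps)
    then show "x^2 / (h - l) \<le> x^2 / (h - l')" "x \<noteq> 0 \<Longrightarrow> x^2 / (h - l) < x^2 / (h - l')"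
      using mult_left_mono[of "1 / (h - l)" "1 / (h - l')" "x^2"]
        mult_strict_left_mono[of "1 / (h - l)" "1 / (h - l')" "x^2"] by simp_all
  qed
  have h: "a < l \<or> l' < a" "b < l \<or> l' < b" "c < l \<or> l' < c" using assms by auto
  have "p$1 \<noteq> 0 \<or> p$2 \<noteq> 0 \<or> p$3 \<noteq> 0" using \<open>p \<noteq> 0\<close> by (simp add: vec_eq_iff forall_3)
  then have "(p$1)^2 / (a - l) + (p$2)^2 / (b - l) + (p$3)^2 / (c - l)
      < (p$1)^2 / (a - l') + (p$2)^2 / (b - l') + (p$3)^2 / (c - l')"
    using *[OF h(1), of "p$1"] *[OF h(2), of "p$2"] *[OF h(3), of "p$3"]
      **[OF h(1), of "p$1"] **[OF h(2), of "p$2"] **[OF h(3), of "p$3"] by linarith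
  then show ?thesis by (simp add: confocal_form_def power2_eq_square)
qed

lemma confocal_excess_origin: "confocal_excess a b c 0 l = - 1"
  by (simp add: confocal_form_def)

lemma continuous_confocal_excess:
  "l \<notin> {a, b, c} \<Longrightarrow> continuous_on UNIV (\<lambda>p. confocal_excess a b c p l)"
  unfolding confocal_form_def by (intro continuous_intros) auto

text \<open>Clearing denominators turns membership in a confocal quadric into a cubic equation. The
  cubic \<open>chi\<close> is negative, positive, negative at \<open>c\<close>, \<open>b\<close>,
  \<open>a\<close> and positive far to the left, so each of the three intervals contains exactly one
  root.\<close>

lemma generic_pointsI:
  assumes "c < b" "b < a" "p$1 \<noteq> 0" "p$2 \<noteq> 0" "p$3 \<noteq> 0"
  shows "p \<in> generic_points a b c"
proof -
  define x y z where "x = (p$1)^2" and "y = (p$2)^2" and "z = (p$3)^2"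
  have xyz: "x > 0" "y > 0" "z > 0" using assms by (simp_all add: x_def y_def z_def)
  define chi where "chi = [:a, -1:] * [:b, -1:] * [:c, -1:]
      - smult x ([:b, -1:] * [:c, -1:]) - smult y ([:a, -1:] * [:c, -1:]) - smult z ([:a, -1:] * [:b, -1:])"
  have chi: "poly chi l = (a - l) * (b - l) * (c - l) - x * ((b - l) * (c - l))
      - y * ((a - l) * (c - l)) - z * ((a - l) * (b - l))" for l
    by (simp add: chi_def algebra_simps)
  have chi_eq: "chi = [: a*b*c - x*b*c - y*a*c - z*a*b,
      - (a*b + b*c + a*c) + x*(b+c) + y*(a+c) + z*(a+b), a + b + c - x - y - z, -1 :]"
    by (simp add: chi_def algebra_simps)
  then have chi_deg: "degree chi = 3" and chi_0: "chi \<noteq> 0" by simp_all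
  have quadric: "l \<notin> {a, b, c} \<Longrightarrow> p \<in> confocal_quadric a b c l \<longleftrightarrow> poly chi l = 0" for l
  proof -
    assume l: "l \<notin> {a, b, c}"
    have "p \<in> confocal_quadric a b c l \<longleftrightarrow> x / (a - l) + y / (b - l) + z / (c - l) = 1"
      by (simp add: confocal_quadric_def confocal_form_def x_def y_def z_def power2_eq_square)
    also have "\<dots> \<longleftrightarrow> poly chi l = 0"
      using l unfolding chi by (simp add: divide_simps) (auto simp: algebra_simps)
    finally show ?thesis .
  qed
  have "poly chi a = - (x * ((a - b) * (a - c)))" unfolding chi by (simp add: algebra_simps)
  then have sa: "poly chi a < 0" using xyz assms by simp
  have "poly chi b = y * ((a - b) * (b - c))" unfolding chi by (simp add: algebra_simps)
  then have sb: "poly chi b > 0" using xyz assms by simp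
  have "poly chi c = - (z * ((a - c) * (b - c)))" unfolding chi by (simp add: algebra_simps)
  then have sc: "poly chi c < 0" using xyz assms by simp
  have "\<exists>l<c. poly chi l > 0"
  proof -
    \<comment> \<open>Here \<open>c - l\<close> exceeds \<open>x + y + z\<close> by 1, and the
      subtracted products are at most \<open>x\<close>, \<open>y\<close> and \<open>z\<close> times
      \<open>(a - l) * (b - l)\<close>.\<close>
    define l where "l = c - (x + y + z) - 1"
    have "l < c" using xyz by (simp add: l_def)
    have 1: "(a - l) * (b - l) * (c - l) = (c - l) * ((a - l) * (b - l))" by simp
    have cl: "c - l = x + y + z + 1" by (simp add: l_def)
    have A: "(b - l) * (c - l) \<le> (a - l) * (b - l)" "(a - l) * (c - l) \<le> (a - l) * (b - l)"
      using assms \<open>l < c\<close> by (auto simp: mult.commute[of "b - l" "c - l"] intro!: mult_mono mult_left_mono)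
    have "x * ((b - l) * (c - l)) \<le> x * ((a - l) * (b - l))" "y * ((a - l) * (c - l)) \<le> y * ((a - l) * (b - l))"
      using A xyz by simp_all
    moreover have "(a - l) * (b - l) > 0" using assms \<open>l < c\<close> by simp
    ultimately have "poly chi l > 0" unfolding chi 1 unfolding cl by (simp add: distrib_right)
    then show ?thesis using \<open>l < c\<close> by blast
  qed
  then obtain l where l: "l < c" "poly chi l > 0" by blast
  obtain m0 where m0: "l < m0" "m0 < c" "poly chi m0 = 0" using poly_IVT_neg[OF l sc] by blast
  obtain m1 where m1: "c < m1" "m1 < b" "poly chi m1 = 0" using poly_IVT_pos[OF assms(1) sc sb] by blast
  obtain m2 where m2: "b < m2" "m2 < a" "poly chi m2 = 0" using poly_IVT_neg[OF assms(2) sb sa] by blast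
  have sub: "{m0, m1, m2} \<subseteq> {l. poly chi l = 0}" using m0 m1 m2 by auto
  have "card {m0, m1, m2} = 3" using m0 m1 m2 by auto
  moreover have "card {l. poly chi l = 0} \<le> 3" using card_poly_roots_bound[OF chi_0] chi_deg by simp
  ultimately have "{m0, m1, m2} = {l. poly chi l = 0}"
    using card_seteq[OF poly_roots_finite[OF chi_0] sub] by simp
  moreover have "{l. l \<notin> {a, b, c} \<and> p \<in> confocal_quadric a b c l} = {l. poly chi l = 0}"
  proof (intro Collect_cong)
    fix l show "(l \<notin> {a, b, c} \<and> p \<in> confocal_quadric a b c l) = (poly chi l = 0)"
      using quadric[of l] sa sb sc by (cases "l \<in> {a, b, c}") auto
  qed
  ultimately have "generic_elliptic_coords a b c p (\<lambda>j. if j = 0 then m0 else if j = 1 then m1 else m2)"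
    using m0 m1 m2 by (auto simp: generic_elliptic_coords_def)
  then show ?thesis by (auto simp: generic_points_def)
qed

text \<open>Makes the \<open>Lim\<close> in \<open>elliptic_coord\<close> unique. Moving along
  \<open>v\<close> enlarges the absolute value of every coordinate, so none of them
  vanishes.\<close>

lemma generic_points_limpt:
  assumes "c < b" "b < a"
  shows "at p within generic_points a b c \<noteq> bot"
proof -
  define v :: "real^3" where "v = (\<chi> i. if p$i \<ge> 0 then 1 else - 1)"
  have "v \<noteq> 0" by (auto simp: v_def vec_eq_iff)
  have "\<exists>x\<in>generic_points a b c. x \<noteq> p \<and> dist x p < e" if "e > 0" for e
  proof (rule bexI)
    define t where "t = e / (2 * norm v)"
    have t: "t > 0" using \<open>v \<noteq> 0\<close> that by (simp add: t_def)
    have nz: "(p + t *\<^sub>R v) $ i \<noteq> 0" for i using t by (auto simp: v_def)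
    show "p + t *\<^sub>R v \<in> generic_points a b c"
      by (intro generic_pointsI assms nz)
    show "p + t *\<^sub>R v \<noteq> p \<and> dist (p + t *\<^sub>R v) p < e"
      using t \<open>v \<noteq> 0\<close> that by (simp add: dist_norm t_def)
  qed
  then have "p islimpt generic_points a b c" by (auto simp: islimpt_approachable)
  then show ?thesis by (simp add: trivial_limit_within)
qed

text \<open>The three coordinates range over disjoint intervals, so the set of parameters determines
  \<open>m 1\<close> and the description by \<open>THE\<close> is legitimate.\<close>

lemma generic_elliptic_coord_1:
  assumes "x \<in> generic_points a b c"
  defines "y \<equiv> THE y. \<exists>m. generic_elliptic_coords a b c x m \<and> y = m 1"
  shows "c < y" "y < b" "confocal_excess a b c x y = 0"
proof -
  obtain m where m: "generic_elliptic_coords a b c x m"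
    using assms by (auto simp: generic_points_def)
  have "y = m 1" unfolding y_def
  proof (rule the_equality)
    show "\<exists>m'. generic_elliptic_coords a b c x m' \<and> m 1 = m' 1" using m by blast
    fix z assume "\<exists>m'. generic_elliptic_coords a b c x m' \<and> z = m' 1"
    then obtain m' where m': "generic_elliptic_coords a b c x m'" "z = m' 1" by blast
    then have "z \<in> {m 0, m 1, m 2}" using m unfolding generic_elliptic_coords_def by blast
    then show "z = m 1" using m m' by (auto simp: generic_elliptic_coords_def)
  qed
  moreover have "m 1 \<in> {l. l \<notin> {a, b, c} \<and> x \<in> confocal_quadric a b c l}"
    using m unfolding generic_elliptic_coords_def by blast
  ultimately show "c < y" "y < b" "confocal_excess a b c x y = 0"
    using m by (auto simp: generic_elliptic_coords_def confocal_quadric_def)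
qed

text \<open>Turns a coordinate defined by a limit into membership in a quadric, also at points that
  are not generic. The limit is found by comparing signs: the excess is continuous in the point, and
  at a nonzero point it increases with the parameter.\<close>

lemma elliptic_coord_1_eq_iff:
  assumes "b < a" "c < l" "l < b"
  shows "elliptic_coord a b c 1 p = l \<longleftrightarrow> p \<in> confocal_quadric a b c l"
proof -
  let ?F = "at p within generic_points a b c"
  define f where "f x = (THE y. \<exists>m. generic_elliptic_coords a b c x m \<and> y = m 1)" for x
  \<comment> \<open>Apart from \<open>c\<close>, the set \<open>A\<close> is empty or an initial
    piece of \<open>(c, b)\<close>, and its supremum is the zero of the excess whenever there is
    one. Inserting \<open>c\<close> covers points where the excess is nowhere negative; at the
    origin, where it is constantly \<open>-1\<close>, the supremum is \<open>b\<close>.\<close>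
  define A where "A = insert c {l. c < l \<and> l < b \<and> confocal_excess a b c p l < 0}"
  define L where "L = Sup A"
  have cb: "c < b" using assms by simp
  have gen: "eventually (\<lambda>x. x \<in> generic_points a b c) ?F" by (simp add: eventually_at_filter)
  have A_ne: "A \<noteq> {}" and A_bdd: "bdd_above A" using cb by (auto simp: A_def intro!: bdd_aboveI[of _ b])
  have mono: "u \<le> v" if "c < v" "v < b" "c < u" "u < b" "confocal_excess a b c x u \<le> confocal_excess a b c x v"
    "x \<noteq> 0" for u v x
    using confocal_excess_strict_mono[of b a c v u x] that assms by force
  have tends: "((\<lambda>x. confocal_excess a b c x v) \<longlongrightarrow> confocal_excess a b c p v) ?F" if "c < v" "v < b" for v
    using continuous_confocal_excess[of v a b c] that assms
    by (auto simp: continuous_on_def intro: tendsto_within_subset)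
  have nonzero: "x \<noteq> 0" if "x \<in> generic_points a b c" for x
    using generic_elliptic_coord_1(3)[OF that] confocal_excess_origin by force
  have "(f \<longlongrightarrow> L) ?F"
  proof (rule order_tendstoI)
    fix u assume "u < L"
    then obtain v where v: "v \<in> A" "u < v" unfolding L_def using less_cSup_iff[OF A_ne A_bdd] by blast
    show "eventually (\<lambda>x. u < f x) ?F"
    proof (cases "v = c")
      case True
      show ?thesis using gen
        by eventually_elim (use generic_elliptic_coord_1(1) v True in \<open>force simp: f_def\<close>)
    next
      case False
      then have v': "c < v" "v < b" "confocal_excess a b c p v < 0" using v by (auto simp: A_def)
      have "eventually (\<lambda>x. confocal_excess a b c x v < 0) ?F"
        using order_tendstoD(2)[OF tends[OF v'(1,2)] v'(3)] .
      then show ?thesis using gen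
      proof eventually_elim
        case (elim x)
        note g = generic_elliptic_coord_1[OF elim(2), folded f_def]
        have "v \<le> f x" using mono[OF g(1,2) v'(1,2), of x] g(3) elim nonzero by simp
        then show ?case using v by simp
      qed
    qed
  next
    fix u assume u: "L < u"
    show "eventually (\<lambda>x. f x < u) ?F"
    proof (cases "b \<le> u")
      case True
      show ?thesis using gen
        by eventually_elim (use generic_elliptic_coord_1(2) True in \<open>force simp: f_def\<close>)
    next
      case False
      have upper: "w \<le> L" if "w \<in> A" for w unfolding L_def using cSup_upper[OF that A_bdd] .
      have "c \<le> L" by (rule upper) (simp add: A_def)
      define v where "v = (L + u) / 2"
      have v: "L < v" "v < u" "c < v" "v < b" using u False \<open>c \<le> L\<close> by (auto simp: v_def)
      have "v \<notin> A" using upper v by force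
      then have ge: "confocal_excess a b c p v \<ge> 0" using v by (simp add: A_def)
      then have "p \<noteq> 0" using confocal_excess_origin by force
      then have gt: "confocal_excess a b c p u > 0"
        using confocal_excess_strict_mono[of b a c v u p] assms v False ge by simp
      have "c < u" "u < b" using v False by auto
      then have "eventually (\<lambda>x. confocal_excess a b c x u > 0) ?F"
        by (rule order_tendstoD(1)[OF tends gt])
      then show ?thesis using gen
      proof eventually_elim
        case (elim x)
        note g = generic_elliptic_coord_1[OF elim(2), folded f_def]
        have "f x \<le> u" using mono[OF _ _ g(1,2), of u x] g(3) elim nonzero v False by simp
        moreover have "f x \<noteq> u" using g(3) elim by force
        ultimately show ?case by simp
      qed
    qed
  qed
  then have coord: "elliptic_coord a b c 1 p = L"
    unfolding elliptic_coord_def f_def[symmetric] by (intro tendsto_Lim generic_points_limpt assms cb)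
  \<comment> \<open>A nonzero excess at \<open>l\<close> keeps its sign nearby: a negative one puts
    parameters above \<open>l\<close> into \<open>A\<close>, a positive one bounds \<open>A\<close>
    below \<open>l\<close>.\<close>
  have "L = l \<longleftrightarrow> confocal_excess a b c p l = 0"
  proof
    assume z: "confocal_excess a b c p l = 0"
    then have p: "p \<noteq> 0" using confocal_excess_origin by force
    show "L = l"
    proof (rule antisym)
      show "L \<le> l" unfolding L_def
      proof (rule cSup_least[OF A_ne])
        fix w assume "w \<in> A"
        then show "w \<le> l" using mono[of l w p] assms z p by (auto simp: A_def)
      qed
      show "l \<le> L"
      proof (rule dense_le_bounded[OF assms(2)])
        fix w assume "c < w" "w < l"
        then have "w \<in> A" using confocal_excess_strict_mono[of b a c w l p] assms z p by (auto simp: A_def)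
        then show "w \<le> L" unfolding L_def by (rule cSup_upper[OF _ A_bdd])
      qed
    qed
  next
    assume L: "L = l"
    have cont: "isCont (confocal_excess a b c p) l"
      using assms unfolding confocal_form_def by (intro continuous_intros) auto
    show "confocal_excess a b c p l = 0"
    proof (rule ccontr)
      assume "confocal_excess a b c p l \<noteq> 0"
      then consider "confocal_excess a b c p l < 0" | "confocal_excess a b c p l > 0" by linarith
      then show False
      proof cases
        case 1
        have "eventually (\<lambda>w. confocal_excess a b c p w < 0 \<and> w < b) (at_right l)"
          using cont 1 assms unfolding isCont_def
          by (intro eventually_conj order_tendstoD(2)[OF tendsto_within_subset[of _ _ l UNIV]])
             (auto intro: order_tendstoD(2)[OF tendsto_ident_at])
        moreover have "eventually (\<lambda>w. w > l) (at_right l)" by (simp add: eventually_at_right_less)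
        ultimately have "eventually (\<lambda>w. confocal_excess a b c p w < 0 \<and> w < b \<and> w > l) (at_right l)"
          by eventually_elim simp
        then obtain w where "confocal_excess a b c p w < 0" "w < b" "w > l"
          using eventually_happens'[OF trivial_limit_at_right_real] by blast
        then have "w \<in> A" using assms by (auto simp: A_def)
        then have "w \<le> L" unfolding L_def by (rule cSup_upper[OF _ A_bdd])
        then show False using L \<open>w > l\<close> by simp
      next
        case 2
        have "eventually (\<lambda>w. confocal_excess a b c p w > 0 \<and> w > c) (at_left l)"
          using cont 2 assms unfolding isCont_def
          by (intro eventually_conj order_tendstoD(1)[OF tendsto_within_subset[of _ _ l UNIV]])
             (auto intro: order_tendstoD(1)[OF tendsto_ident_at])
        moreover have "eventually (\<lambda>w. w < l) (at_left l)" by (simp add: eventually_at_left_real eventually_at_filter)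
        ultimately have "eventually (\<lambda>w. confocal_excess a b c p w > 0 \<and> w > c \<and> w < l) (at_left l)"
          by eventually_elim simp
        then obtain w where w: "confocal_excess a b c p w > 0" "w > c" "w < l"
          using eventually_happens'[OF trivial_limit_at_left_real] by blast
        obtain v where v: "v \<in> A" "w < v"
          using w L less_cSup_iff[OF A_ne A_bdd, of w] unfolding L_def by auto
        then have "confocal_excess a b c p v < 0" "v < b" "c < v" using w by (auto simp: A_def)
        then show False using mono[of w v p] v w assms confocal_excess_origin
          using confocal_excess_strict_mono[of b a c w v p] by (cases "p = 0") force+
      qed
    qed
  qed
  then show ?thesis unfolding coord by (simp add: confocal_quadric_def)
qed

section \<open>Complete oscillations\<close>

text \<open>The times are adapted to the orbit constructed below: \<open>t1\<close> and
  \<open>1 - t2\<close> will be the contact parameters of its long chords with the two caustics.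
  Since \<open>t2 < t1\<close>, the value \<open>hi\<close> is taken between any two successive
  visits to \<open>lo\<close>.\<close>

lemma complete_oscillations_eq_3:
  fixes f :: "real \<Rightarrow> real"
  assumes t: "0 < t2" "t2 < t1" "t1 < 1"
    and lo: "\<And>t. f t = lo \<longleftrightarrow>
      (\<exists>j::int. t = 4 * of_int j + 1 / 2 \<or> t = 4 * of_int j + 1 + t1 \<or> t = 4 * of_int j + 4 - t1)"
    and hi: "f (1 + t2) = hi" "f (5 / 2) = hi" "f (4 - t2) = hi"
  shows "complete_oscillations f lo hi 4 = 3"
proof -
  have window: "f u = lo \<longleftrightarrow> u = 1 / 2 \<or> u = 1 + t1 \<or> u = 4 - t1" if "0 \<le> u" "u < 4" for u
  proof
    assume "f u = lo"
    then obtain j :: int where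
      "u = 4 * of_int j + 1 / 2 \<or> u = 4 * of_int j + 1 + t1 \<or> u = 4 * of_int j + 4 - t1"
      unfolding lo by blast
    then have "of_int j > (- 1 :: real) \<and> of_int j < (1 :: real) \<and>
        (u = 4 * of_int j + 1 / 2 \<or> u = 4 * of_int j + 1 + t1 \<or> u = 4 * of_int j + 4 - t1)"
      using that t by auto
    moreover from this have "j = 0" by linarith
    ultimately show "u = 1 / 2 \<or> u = 1 + t1 \<or> u = 4 - t1" by simp
  next
    assume "u = 1 / 2 \<or> u = 1 + t1 \<or> u = 4 - t1"
    then show "f u = lo" unfolding lo by (intro exI[of _ 0]) auto
  qed
  \<comment> \<open>The oscillation that starts at \<open>4 - t1\<close> ends only in the next
    period, at \<open>9 / 2\<close>.\<close>
  have after: "f u \<noteq> lo" if "4 - t1 < u" "u < 9 / 2" for u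
  proof
    assume "f u = lo"
    then obtain j :: int where j:
      "u = 4 * of_int j + 1 / 2 \<or> u = 4 * of_int j + 1 + t1 \<or> u = 4 * of_int j + 4 - t1"
      unfolding lo by blast
    have "of_int j > (0 :: real)" "of_int j < (1 :: real)" using j that t by auto
    then have "0 < j" "j < 1" by simp_all
    then show False by linarith
  qed
  have next_lo: "f (9 / 2) = lo" unfolding lo by (intro exI[of _ 1]) simp
  have "{s. 0 \<le> s \<and> s < 4 \<and> f s = lo \<and>
              (\<exists>t>s. f t = lo \<and> (\<forall>u. s < u \<and> u < t \<longrightarrow> f u \<noteq> lo) \<and>
                     (\<exists>u. s < u \<and> u < t \<and> f u = hi))} = {1 / 2, 1 + t1, 4 - t1}" (is "?A = ?B")
  proof
    show "?A \<subseteq> ?B" using window by blast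
    show "?B \<subseteq> ?A"
    proof (intro subsetI CollectI)
      fix s assume "s \<in> ?B"
      then consider "s = 1 / 2" | "s = 1 + t1" | "s = 4 - t1" by blast
      then obtain u v where uv: "s < u" "u < v" "f u = hi" "f v = lo" "\<forall>w. s < w \<and> w < v \<longrightarrow> f w \<noteq> lo"
      proof cases
        case 1
        show ?thesis
          by (rule that[of "1 + t2" "1 + t1"]) (use 1 window t hi in auto)
      next
        case 2
        show ?thesis
          by (rule that[of "5 / 2" "4 - t1"]) (use 2 window t hi in auto)
      next
        case 3
        show ?thesis
          by (rule that[of "4 - t2" "9 / 2"]) (use 3 t hi next_lo after in auto)
      qed
      have "0 \<le> s" "s < 4" "f s = lo" using \<open>s \<in> ?B\<close> t window by auto
      moreover have "s < v" using uv(1,2) by (rule less_trans)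
      ultimately show "0 \<le> s \<and> s < 4 \<and> f s = lo \<and>
              (\<exists>t>s. f t = lo \<and> (\<forall>u. s < u \<and> u < t \<longrightarrow> f u \<noteq> lo) \<and>
                     (\<exists>u. s < u \<and> u < t \<and> f u = hi))"
        using uv by blast
    qed
  qed
  moreover have "card {1 / 2, 1 + t1, 4 - t1} = 3" using t by auto
  ultimately show ?thesis unfolding complete_oscillations_def by simp
qed

section \<open>The polynomial data of the caustics\<close>

text \<open>
  \<open>l\<close> and \<open>m\<close> are deliberately left unordered: exchanging them exchanges the caustics, and also the two
  halves of the trajectory constructed below.
\<close>

locale four_periodic =
  fixes al be ka sg l m :: real
  assumes sg_pos: "0 < sg" and sg_al: "sg < al" and al_be: "al < be"
    and be_l: "be < l" and be_m: "be < m" and l_ka: "l < ka" and m_ka: "m < ka"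
    and e1: "al + be + ka = 2 * sg + l + m"
    and e2: "al * be + al * ka + be * ka = sg^2 + 2 * sg * (l + m) + l * m"
    and e3: "al * be * ka = sg^2 * (l + m) + 2 * sg * l * m"
begin

lemma swap: "four_periodic al be ka sg m l"
  using sg_pos sg_al al_be be_l be_m l_ka m_ka e1 e2 e3
  by unfold_locales (simp_all add: algebra_simps)

lemma pos: "0 < al" "0 < be" "0 < ka" "0 < l" "0 < m" "al < l" "al < m" "be < ka" "al < ka"
  "sg < l" "sg < m" "sg < be" "sg < ka"
  using sg_pos sg_al al_be be_l be_m l_ka m_ka by linarith+

text \<open>The relations \<open>e1\<close>, \<open>e2\<close>, \<open>e3\<close> say that the
  coefficients of \<open>x^3\<close>, \<open>x^2\<close> and \<open>x\<close> agree.\<close>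

lemma quartic:
  "(x - sg)^2 * ((x - l) * (x - m)) = x * (x - al) * (x - be) * (x - ka) + sg^2 * l * m"
proof -
  have "x * (x - al) * (x - be) * (x - ka)
      = x^4 - (al + be + ka) * x^3 + (al * be + al * ka + be * ka) * x^2 - (al * be * ka) * x"
    by algebra
  also have "\<dots> = x^4 - (2 * sg + l + m) * x^3 + (sg^2 + 2 * sg * (l + m) + l * m) * x^2
      - (sg^2 * (l + m) + 2 * sg * l * m) * x"
    by (simp only: e1 e2 e3)
  finally show ?thesis by algebra
qed

lemma root_al: "(al - sg)^2 * ((l - al) * (m - al)) = sg^2 * l * m"
  and root_be: "(be - sg)^2 * ((l - be) * (m - be)) = sg^2 * l * m"
  and root_ka: "(ka - sg)^2 * ((ka - l) * (ka - m)) = sg^2 * l * m"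
  using quartic[of al] quartic[of be] quartic[of ka] by (simp_all add: algebra_simps)

lemma root_l: "(l - al) * (l - be) * (ka - l) = sg^2 * m"
proof -
  have "l * ((l - al) * (l - be) * (ka - l)) = l * (sg^2 * m)"
    using quartic[of l] by (simp add: algebra_simps)
  then show ?thesis using pos by simp
qed

end

section \<open>Branch points for caustic type H1H1, and the discriminant of the pair of
  caustics\<close>

lemma cseq_H1H1:
  assumes "0 < c" "c < l1" "l1 < l2" "l2 < b" "b < a"
  shows "cseq a b c l1 l2 = [0, c, l1, l2, b, a]"
proof -
  have "sorted_list_of_set {a, b, c, l1, l2} = [c, l1, l2, b, a]"
    using sorted_list_of_set.idem_if_sorted_distinct[of "[c, l1, l2, b, a]"] assms
    by (simp add: insert_commute)
  then show ?thesis by (simp add: cseq_def)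
qed

lemma gamma_H1H1:
  assumes "0 < c" "c < l1" "l1 < l2" "l2 < b" "b < a"
  shows "gamma_seq a b c l1 l2 1 = 1 / c" "gamma_seq a b c l1 l2 (Suc 0) = 1 / c" "gamma_seq a b c l1 l2 2 = 1 / l1"
    "gamma_seq a b c l1 l2 3 = 1 / l2" "gamma_seq a b c l1 l2 4 = 1 / b"
    "gamma_seq a b c l1 l2 5 = 1 / a" "gamma_seq a b c l1 l2 6 = 0"
  by (simp_all add: gamma_seq_def cseq_H1H1[OF assms] nth_Cons')

lemma R_poly_H1H1:
  assumes "0 < c" "c < l1" "l1 < l2" "l2 < b" "b < a"
  shows "R_poly a b c l1 l2
    = [:0, 1:] * [:- (1 / c), 1:] * [:- (1 / l1), 1:] * [:- (1 / l2), 1:] * [:- (1 / b), 1:] * [:- (1 / a), 1:]"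
proof -
  have "{1..5::nat} = {1, 2, 3, 4, 5}" by auto
  then show ?thesis using gamma_H1H1[OF assms] by (simp add: R_poly_def mult_ac del: mult_pCons_left mult_pCons_right)
qed

text \<open>The hypothesis makes \<open>sg\<close> a critical point of
  \<open>x (x - al) (x - be) (x - ka)\<close>. The first factor on the left is the discriminant of
  the quadratic with roots \<open>l\<close> and \<open>m\<close>, so its sign is that of
  \<open>ka - al - be\<close> once the other factors are positive. The two sides differ by 8 times
  the critical equation.\<close>

lemma discriminant_identity:
  fixes al be ka sg :: real
  assumes "4 * sg^3 - 3 * (al + be + ka) * sg^2 + 2 * (al * be + al * ka + be * ka) * sg - al * be * ka = 0"
  shows "((al + be + ka - 2 * sg)^2 - 4 * (al * be + al * ka + be * ka - 2 * sg * (al + be + ka - 2 * sg) - sg^2))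
      * (al + be + ka - 4 * sg) = (ka - al - be) * (ka + al - be) * (ka + be - al)" (is "?L = ?R")
proof -
  have "?L - ?R
    = 8 * (4 * sg^3 - 3 * (al + be + ka) * sg^2 + 2 * (al * be + al * ka + be * ka) * sg - al * be * ka)"
    by algebra
  also have "\<dots> = 0" by (simp only: assms mult_zero_right)
  finally show ?thesis by (simp only: right_minus_eq)
qed

context four_periodic
begin

lemma critical:
  "4 * sg^3 - 3 * (al + be + ka) * sg^2 + 2 * (al * be + al * ka + be * ka) * sg - al * be * ka = 0"
  unfolding e1 e2 e3 by algebra

lemma order_inverse:
  assumes "m < l"
  shows "0 < 1 / ka" "1 / ka < 1 / l" "1 / l < 1 / m" "1 / m < 1 / be" "1 / be < 1 / al"
  using pos l_ka be_m al_be assms by (simp_all add: divide_strict_left_mono)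

text \<open>For distinct \<open>l\<close> and \<open>m\<close> the discriminant
  \<open>(l - m)^2\<close> is positive, and \<open>discriminant_identity\<close> passes the sign on
  to \<open>ka - al - be\<close>.\<close>

lemma longest_axis_bound:
  assumes "l \<noteq> m"
  shows "al + be < ka"
proof -
  have s: "al + be + ka - 2 * sg = l + m" using e1 by simp
  have "al * be + al * ka + be * ka - 2 * sg * (al + be + ka - 2 * sg) - sg^2 = l * m"
    unfolding s e2 by simp
  then have "((l + m)^2 - 4 * (l * m)) * (al + be + ka - 4 * sg)
      = (ka - al - be) * (ka + al - be) * (ka + be - al)"
    using discriminant_identity[OF critical] unfolding s by simp
  moreover have "(l + m)^2 - 4 * (l * m) = (l - m)^2" by algebra
  moreover have "al + be + ka - 4 * sg > 0" using e1 pos by simp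
  moreover have "(l - m)^2 > 0" using assms by simp
  ultimately have "(ka - al - be) * (ka + al - be) * (ka + be - al) > 0" by (metis mult_pos_pos)
  moreover have "ka + al - be > 0" "ka + be - al > 0" using pos by auto
  ultimately show ?thesis by (simp add: zero_less_mult_iff)
qed

end

lemma four_periodic_exists:
  fixes al be ka sg :: real
  assumes "0 < sg" "sg < al" "al < be" "be < ka" "al + be < ka"
    and crit: "4 * sg^3 - 3 * (al + be + ka) * sg^2 + 2 * (al * be + al * ka + be * ka) * sg - al * be * ka = 0"
  shows "\<exists>l m. m < l \<and> four_periodic al be ka sg l m"
proof -
  \<comment> \<open>\<open>s\<close> and \<open>e\<close> are the values of \<open>l + m\<close> and
    \<open>l * m\<close> forced by the first two relations of \<open>four_periodic\<close>; the
    third is then the critical equation.\<close>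
  define s where "s = al + be + ka - 2 * sg"
  define e where "e = al * be + al * ka + be * ka - 2 * sg * s - sg^2"
  define D where "D = s^2 - 4 * e"
  have "D * (al + be + ka - 4 * sg) = (ka - al - be) * (ka + al - be) * (ka + be - al)"
    using discriminant_identity[OF crit] by (simp add: D_def s_def e_def)
  also have "\<dots> > 0" using assms by simp
  finally have D: "D > 0" using assms by (simp add: zero_less_mult_iff)
  define l m where "l = (s + sqrt D) / 2" and "m = (s - sqrt D) / 2"
  have "m < l" using D by (simp add: l_def m_def)
  have sum: "l + m = s" by (simp add: l_def m_def add_divide_distrib[symmetric])
  have "l * m = (s^2 - (sqrt D)^2) / 4" by (simp add: l_def m_def power2_eq_square algebra_simps)
  then have prod: "l * m = e" using D by (simp add: D_def)
  have "2 * sg * e + sg^2 * s - al * be * ka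
    = 4 * sg^3 - 3 * (al + be + ka) * sg^2 + 2 * (al * be + al * ka + be * ka) * sg - al * be * ka"
    unfolding e_def s_def by algebra
  then have e3: "al * be * ka = 2 * sg * e + sg^2 * s" using crit by simp
  have e1: "al + be + ka = s + 2 * sg" and e2: "al * be + al * ka + be * ka = e + 2 * sg * s + sg^2"
    by (simp_all add: e_def s_def)
  have h: "(x - sg)^2 * ((x - l) * (x - m)) = x * (x - al) * (x - be) * (x - ka) + sg^2 * e" for x
  proof -
    have "(x - l) * (x - m) = x^2 - s * x + e"
      unfolding sum[symmetric] prod[symmetric] by (simp add: algebra_simps power2_eq_square)
    moreover have "x * (x - al) * (x - be) * (x - ka)
      = x^4 - (al + be + ka) * x^3 + (al * be + al * ka + be * ka) * x^2 - (al * be * ka) * x"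
      by algebra
    ultimately show ?thesis unfolding e1 e2 e3 by algebra
  qed
  have "sg^2 * e = sg * (al - sg) * (be - sg) * (ka - sg)" using h[of sg] by (simp add: algebra_simps)
  also have "\<dots> > 0" using assms by simp
  finally have e: "e > 0" by (simp add: zero_less_mult_iff)
  then have e': "sg^2 * e > 0" using assms by simp
  \<comment> \<open>The quartic in \<open>h\<close> is positive at \<open>be\<close> and at
    \<open>ka\<close>, so \<open>l\<close> and \<open>m\<close> lie on the same side of each; the
    size of their sum decides which side.\<close>
  have "(be - sg)^2 * ((be - l) * (be - m)) > 0" using h[of be] e' by simp
  then have hbe: "(be - l) * (be - m) > 0" by (simp add: zero_less_mult_iff)
  have "(ka - sg)^2 * ((ka - l) * (ka - m)) > 0" using h[of ka] e' by simp
  then have hka: "(ka - l) * (ka - m) > 0" by (simp add: zero_less_mult_iff)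
  have "four_periodic al be ka sg l m"
  proof
    show "be < l" "be < m" using hbe sum assms \<open>m < l\<close> by (auto simp: zero_less_mult_iff s_def)
    show "l < ka" "m < ka" using hka sum assms \<open>m < l\<close> by (auto simp: zero_less_mult_iff s_def)
    show "al + be + ka = 2 * sg + l + m" using sum by (simp add: s_def)
    show "al * be + al * ka + be * ka = sg^2 + 2 * sg * (l + m) + l * m"
      unfolding prod sum e_def by simp
    show "al * be * ka = sg^2 * (l + m) + 2 * sg * l * m"
      unfolding e3 prod[symmetric] sum[symmetric] by algebra
  qed (use assms in auto)
  then show ?thesis using \<open>m < l\<close> by blast
qed

section \<open>The quartic forced by the signature\<close>

lemma poly_eq_of_monic_roots:
  fixes p q :: "real poly"
  assumes "degree p = n" "degree q = n" "lead_coeff p = 1" "lead_coeff q = 1"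
    and "card A \<ge> n" "\<And>x. x \<in> A \<Longrightarrow> poly p x = poly q x"
  shows "p = q"
  using assms by (intro poly_eqI_degree_lead_coeff[where n = n and A = A]) auto

text \<open>
  On each of the gaps \<open>(\<alpha>, \<beta>)\<close> and \<open>(1 / \<lambda>\<^sub>2, 1 / \<lambda>\<^sub>1)\<close> the polynomial \<open>P\<close> takes equal values at the ends,
  as \<open>P (P - P 0)\<close> is positive inside; together with the double root of \<open>S\<^sup>2\<close> this accounts for the
  three zeros of \<open>P'\<close>, so that \<open>P\<close> is injective on each band and its values at the branch
  points are forced to alternate.
\<close>

lemma signature_imp_four_periodic:
  assumes ord: "0 < c" "c < l1" "l1 < l2" "l2 < b" "b < a"
    and sig: "has_signature a b c l1 l2 4 [0, 0, 1]"
  shows "\<exists>sg. four_periodic (1 / a) (1 / b) (1 / c) sg (1 / l1) (1 / l2)"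
proof -
  define al be ka l m where "al = 1 / a" and "be = 1 / b" and "ka = 1 / c" and "l = 1 / l1" and "m = 1 / l2"
  have o: "0 < al" "al < be" "be < m" "m < l" "l < ka"
    using ord by (simp_all add: al_def be_def ka_def l_def m_def divide_strict_left_mono)
  obtain S P :: "real poly" where S: "lead_coeff S = 1" "degree S = 1" and P: "lead_coeff P = 1" "degree P = 4"
    and P0: "poly P 0 \<noteq> 0" and eq: "S^2 * R_poly a b c l1 l2 = P * (P - [:poly P 0:])"
    and roots: "\<forall>r\<in>{1, 2, 3}. card {x. poly S x = 0 \<and> gamma_seq a b c l1 l2 (2 * r) < x \<and>
                    x < gamma_seq a b c l1 l2 (2 * r - 1)} = [0, 0, 1] ! (r - 1)"
    using sig unfolding has_signature_def by (elim conjE exE) simp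
  have "card {x. poly S x = 0 \<and> 0 < x \<and> x < al} = 1"
    using roots gamma_H1H1[OF ord] by (simp add: al_def)
  then have "{x. poly S x = 0 \<and> 0 < x \<and> x < al} \<noteq> {}" by (metis card.empty zero_neq_one)
  then obtain sg where sg: "poly S sg = 0" "0 < sg" "sg < al" by blast
  have "S = [:- sg, 1:]"
    by (rule poly_eq_of_monic_roots[where n = 1 and A = "{sg}"]) (use S sg in auto)
  define p0 where "p0 = poly P 0"
  have p0: "p0 \<noteq> 0" using P0 by (simp add: p0_def)
  then have pp: "0 < p0 * p0" using not_real_square_gt_zero[of p0] by blast
  define Q where "Q = [:0, 1:] * [:- al, 1:] * [:- be, 1:] * [:- ka, 1:]"
  define T where "T = [:- sg, 1:]^2 * [:- l, 1:] * [:- m, 1:]"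
  have TQ: "T * Q = P * (P - [:p0:])"
    using eq unfolding \<open>S = _\<close> R_poly_H1H1[OF ord] p0_def T_def Q_def al_def be_def ka_def l_def m_def
    by (simp only: mult_ac)
  have val: "(x - sg)^2 * (x - l) * (x - m) * (x * (x - al) * (x - be) * (x - ka)) = poly P x * (poly P x - p0)" for x
    using arg_cong[OF TQ, of "\<lambda>p. poly p x"]
    by (simp add: T_def Q_def mult_ac del: mult_pCons_left mult_pCons_right)
  \<comment> \<open>If the end values were \<open>0\<close> and \<open>p0\<close>, the value
    \<open>p0 / 2\<close> would occur in between, where \<open>P (P - p0)\<close> is
    negative.\<close>
  have gap: "poly P u = poly P v" if "u < v" "poly P u = 0 \<or> poly P u = p0" "poly P v = 0 \<or> poly P v = p0"
    "\<And>x. u < x \<Longrightarrow> x < v \<Longrightarrow> (x - sg)^2 * (x - l) * (x - m) * (x * (x - al) * (x - be) * (x - ka)) > 0" for u v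
  proof (rule ccontr)
    note uv = that
    assume "poly P u \<noteq> poly P v"
    then have "poly (P - [:p0 / 2:]) u * poly (P - [:p0 / 2:]) v = - (p0 * p0) / 4" using that by auto
    also have "\<dots> < 0" using pp by simp
    finally obtain x where x: "u < x" "x < v" "poly (P - [:p0 / 2:]) x = 0" using poly_IVT[OF uv(1)] by blast
    then have half: "poly P x = p0 / 2" by simp
    have "poly P x * (poly P x - p0) = - (p0 * p0) / 4" unfolding half by (simp add: field_simps)
    also have "\<dots> < 0" using pp by simp
    finally show False using val[of x] uv(4)[OF x(1,2)] by simp
  qed
  have two: "poly P x = 0 \<or> poly P x = p0" if "x \<in> {sg, al, be, l, m, ka}" for x
    using val[of x] that by auto
  have gap1: "poly P al = poly P be"
  proof (rule gap)
    fix x assume x: "al < x" "x < be"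
    have "(x - sg)^2 * (x - l) * (x - m) * (x * (x - al) * (x - be) * (x - ka))
        = (x - sg)^2 * (l - x) * (m - x) * (x * (x - al) * (be - x) * (ka - x))" by algebra
    also have "\<dots> > 0" using x o sg by simp
    finally show "(x - sg)^2 * (x - l) * (x - m) * (x * (x - al) * (x - be) * (x - ka)) > 0" .
  qed (use two o in auto)
  have gap2: "poly P m = poly P l"
  proof (rule gap)
    fix x assume x: "m < x" "x < l"
    have "(x - sg)^2 * (x - l) * (x - m) * (x * (x - al) * (x - be) * (x - ka))
        = (x - sg)^2 * (l - x) * (x - m) * (x * (x - al) * (x - be) * (ka - x))" by algebra
    also have "\<dots> > 0" using x o sg by simp
    finally show "(x - sg)^2 * (x - l) * (x - m) * (x * (x - al) * (x - be) * (x - ka)) > 0" .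
  qed (use two o in auto)
  have dP: "degree (pderiv P) = 3" "pderiv P \<noteq> 0" using P by (auto simp: degree_pderiv pderiv_eq_0_iff)
  \<comment> \<open>The left side of \<open>TQ\<close> has a double zero at \<open>sg\<close>.
    Differentiating the right side gives \<open>P' (2 P - p0)\<close>, whose second factor is
    \<open>p0\<close> or \<open>- p0\<close> at \<open>sg\<close>.\<close>
  have r0: "poly (pderiv P) sg = 0"
  proof -
    have "poly (pderiv (T * Q)) sg = 0"
      by (simp add: T_def pderiv_mult power2_eq_square del: mult_pCons_left mult_pCons_right)
    then have "poly (pderiv P) sg * (2 * poly P sg - p0) = 0"
      unfolding TQ by (simp add: pderiv_mult pderiv_diff pderiv_smult algebra_simps)
    then show ?thesis using two[of sg] p0 by auto
  qed
  have rolle: "\<exists>x. u < x \<and> x < v \<and> poly (pderiv P) x = 0" if "u < v" "poly P u = poly P v" for u v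
    using poly_MVT[OF that(1), of P] that by auto
  obtain r1 where r1: "al < r1" "r1 < be" "poly (pderiv P) r1 = 0" using rolle[OF o(2) gap1] by blast
  obtain r2 where r2: "m < r2" "r2 < l" "poly (pderiv P) r2 = 0" using rolle[OF o(4) gap2] by blast
  \<comment> \<open>Another zero of \<open>P'\<close> between \<open>u\<close> and \<open>v\<close>
    would be the fourth, against degree 3.\<close>
  have band: "poly P u \<noteq> poly P v" if "u < v" "v \<le> sg \<or> sg \<le> u" "v \<le> r1 \<or> r1 \<le> u" "v \<le> r2 \<or> r2 \<le> u" for u v
  proof
    note uv = that
    assume "poly P u = poly P v"
    then obtain x where x: "u < x" "x < v" "poly (pderiv P) x = 0" using rolle[OF uv(1)] by blast
    then have "card {x, sg, r1, r2} = 4" using that r1 r2 o sg by auto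
    moreover have "card {x, sg, r1, r2} \<le> card {x. poly (pderiv P) x = 0}"
      using r0 r1 r2 x dP by (intro card_mono poly_roots_finite) auto
    ultimately show False using card_poly_roots_bound[OF dP(2)] dP(1) by simp
  qed
  \<comment> \<open>On the bands from \<open>0\<close> to \<open>sg\<close>, \<open>sg\<close> to
    \<open>al\<close>, \<open>be\<close> to \<open>m\<close> and \<open>l\<close> to
    \<open>ka\<close> the value switches between \<open>p0\<close> and \<open>0\<close>, and across
    the two gaps it is kept. Hence \<open>P\<close> equals \<open>p0\<close> at the four roots of
    \<open>Q\<close>.\<close>
  have "poly P 0 \<noteq> poly P sg" using sg r1 r2 o by (intro band) auto
  then have "poly P sg = 0" using two[of sg] by (auto simp: p0_def)
  moreover have "poly P sg \<noteq> poly P al" using sg r1 r2 o by (intro band) auto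
  ultimately have Pal: "poly P al = p0" using two[of al] by auto
  then have Pbe: "poly P be = p0" using gap1 by simp
  moreover have "poly P be \<noteq> poly P m" using sg r1 r2 o by (intro band) auto
  ultimately have "poly P l = 0" using two[of m] gap2 by auto
  moreover have "poly P l \<noteq> poly P ka" using sg r1 r2 o by (intro band) auto
  ultimately have Pka: "poly P ka = p0" using two[of ka] by auto
  have PQ: "P - [:p0:] = Q"
  proof (rule poly_eq_of_monic_roots[where n = 4 and A = "{0, al, be, ka}"])
    have *: "degree (P - [:p0:]) = degree P"
      using degree_add_eq_left[of "- [:p0:]" P] P by (simp only: diff_conv_add_uminus) simp
    then show "degree (P - [:p0:]) = 4" "lead_coeff (P - [:p0:]) = 1"
      using P by (simp_all add: coeff_pCons split: nat.split)
    show "degree Q = 4" by (simp add: Q_def degree_mult_eq)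
    show "lead_coeff Q = 1" by (simp add: Q_def lead_coeff_mult del: mult_pCons_left mult_pCons_right)
    show "4 \<le> card {0, al, be, ka}" using o by auto
  qed (use Pal Pbe Pka in \<open>auto simp: Q_def p0_def simp del: mult_pCons_left mult_pCons_right\<close>)
  \<comment> \<open>Cancelling \<open>Q\<close> identifies \<open>P\<close> with \<open>T\<close>;
    comparing coefficients in \<open>T = Q + p0\<close> then gives the three relations.\<close>
  then have "T * Q = P * Q" using TQ by simp
  moreover have "Q \<noteq> 0" by (simp add: Q_def)
  ultimately have "T = Q + [:p0:]" using PQ by (metis diff_add_cancel mult_right_cancel)
  then have "four_periodic al be ka sg l m"
    using o sg unfolding T_def Q_def
    by unfold_locales (auto simp: power2_eq_square algebra_simps)
  then show ?thesis unfolding al_def be_def ka_def l_def m_def by blast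
qed

text \<open>\<open>P\<close> is the left side of \<open>quartic\<close>, and the only zero
  \<open>sg\<close> of \<open>S\<close> lies in the interval \<open>(0, al)\<close> of index
  3.\<close>

lemma (in four_periodic) has_signature:
  assumes "m < l"
  shows "has_signature (1 / al) (1 / be) (1 / ka) (1 / l) (1 / m) 4 [0, 0, 1]"
proof -
  note ord = order_inverse[OF assms]
  define S where "S = [:- sg, 1:]"
  define P where "P = [:- sg, 1:]^2 * [:- l, 1:] * [:- m, 1:]"
  have P0: "poly P 0 = sg^2 * l * m" by (simp add: P_def)
  have PQ: "P - [:poly P 0:] = [:0, 1:] * [:- al, 1:] * [:- be, 1:] * [:- ka, 1:]"
  proof -
    have "poly (P - [:poly P 0:]) x = poly ([:0, 1:] * [:- al, 1:] * [:- be, 1:] * [:- ka, 1:]) x" for x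
      using quartic[of x] unfolding P0 by (simp add: P_def algebra_simps)
    then show ?thesis by (simp add: poly_eq_poly_eq_iff[symmetric] fun_eq_iff del: mult_pCons_left mult_pCons_right)
  qed
  have ordS: "{x. order x S = 1} = {sg}"
  proof -
    have "order sg S = 1" unfolding S_def using order_power_n_n[of sg 1] by simp
    moreover have "order x S = 0" if "x \<noteq> sg" for x using that by (intro order_0I) (simp add: S_def)
    ultimately show ?thesis by force
  qed
  show ?thesis
    unfolding has_signature_def
  proof (rule conjI, simp, rule conjI, simp, rule exI[of _ S], rule exI[of _ P], intro conjI)
    show "S\<^sup>2 * R_poly (1 / al) (1 / be) (1 / ka) (1 / l) (1 / m) = P * (P - [:poly P 0:])"
      unfolding PQ R_poly_H1H1[OF ord] by (simp add: S_def P_def mult_ac del: mult_pCons_left mult_pCons_right)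
    show "card {x. order x S = 1} = 4 - 3" unfolding ordS by simp
    show "degree P = 4" by (simp add: P_def degree_mult_eq power2_eq_square)
    show "lead_coeff P = 1" by (simp add: P_def lead_coeff_mult power2_eq_square del: mult_pCons_left mult_pCons_right)
    have "{x. sg = x \<and> be < x \<and> x < m} = {}" "{x. sg = x \<and> l < x \<and> x < ka} = {}"
      "{x. x = sg \<and> 0 < x \<and> x < al} = {sg}" using pos sg_pos sg_al by auto
    then show "\<forall>r\<in>{1, 2, 3}. card {x. poly S x = 0 \<and> gamma_seq (1 / al) (1 / be) (1 / ka) (1 / l) (1 / m) (2 * r) < x \<and>
                    x < gamma_seq (1 / al) (1 / be) (1 / ka) (1 / l) (1 / m) (2 * r - 1)} = [0, 0, 1] ! (r - 1)"
      using gamma_H1H1[OF ord] by (simp add: S_def)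
  qed (use P0 sg_pos pos in \<open>simp_all add: S_def\<close>)
qed

section \<open>A symmetric trajectory of period four\<close>

lemma mod_4_cases:
  fixes k :: int
  obtains j where "k = 4 * j" | j where "k = 4 * j + 1" | j where "k = 4 * j + 2" | j where "k = 4 * j + 3"
proof -
  have "k = 4 * (k div 4) + k mod 4" by simp
  moreover have "k mod 4 = 0 \<or> k mod 4 = 1 \<or> k mod 4 = 2 \<or> k mod 4 = 3" by presburger
  ultimately show ?thesis using that by (metis add.right_neutral)
qed

text \<open>
  The signs \<open>e1\<close>, \<open>e2\<close>, \<open>e3\<close> are \<open>\<plusminus>1\<close>, or 0 for projections to coordinate subspaces.
\<close>

definition impact :: "real \<Rightarrow> real \<Rightarrow> real \<Rightarrow> real \<Rightarrow> real \<Rightarrow> real \<Rightarrow> real \<Rightarrow> real \<Rightarrow> real^3" where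
  "impact al be ka l m e1 e2 e3 =
     vector [e1 * sqrt ((l - al) / (al * l)),
             e2 * sqrt (al * (m - be) / (be * l * (ka - be))),
             e3 * sqrt (al * (ka - m) / (ka * l * (ka - be)))]"

context four_periodic
begin

text \<open>\<open>swap\<close> exchanges \<open>q\<close> and \<open>r\<close>, so each fact about
  \<open>q\<close> and the caustic \<open>1 / l\<close> also yields one about \<open>r\<close> and
  \<open>1 / m\<close>.\<close>

abbreviation "q e1 e2 e3 \<equiv> impact al be ka l m e1 e2 e3"
abbreviation "r e1 e2 e3 \<equiv> impact al be ka m l e1 e2 e3"

text \<open>\<open>x0\<close> is the abscissa of the vertex of the caustic \<open>1 / l\<close>. The
  other two are found from the conditions that \<open>(x0, y0, z0)\<close> lies on the ellipsoid and
  that \<open>(0, y0, z0)\<close> is an asymptotic direction of the caustic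
  \<open>1 / m\<close>.\<close>

definition "x0 = sqrt ((l - al) / (al * l))"
definition "y0 = sqrt (al * (m - be) / (be * l * (ka - be)))"
definition "z0 = sqrt (al * (ka - m) / (ka * l * (ka - be)))"

lemma q_nth [simp]:
  "q e1 e2 e3 $ 1 = e1 * x0" "q e1 e2 e3 $ 2 = e2 * y0" "q e1 e2 e3 $ 3 = e3 * z0"
  by (simp_all add: impact_def x0_def y0_def z0_def)

lemma squares:
  "x0^2 = (l - al) / (al * l)"
  "y0^2 = al * (m - be) / (be * l * (ka - be))"
  "z0^2 = al * (ka - m) / (ka * l * (ka - be))"
  using pos be_l be_m l_ka m_ka by (simp_all add: x0_def y0_def z0_def)

lemma sqrt_pos: "0 < x0" "0 < y0" "0 < z0"
  using pos be_l be_m l_ka m_ka by (simp_all add: x0_def y0_def z0_def)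

text \<open>By \<open>root_al\<close>, \<open>root_be\<close> and \<open>root_ka\<close> the ratios
  of corresponding square roots are rational in the parameters. Relations between \<open>q\<close>
  and \<open>r\<close> thereby become rational identities, one for each coordinate.\<close>

lemma r_nth [simp]:
  "r e1 e2 e3 $ 1 = e1 * ((al - sg) * (m - al) / (sg * m) * x0)"
  "r e1 e2 e3 $ 2 = e2 * ((be - sg) * (l - be) / (sg * m) * y0)"
  "r e1 e2 e3 $ 3 = e3 * ((ka - sg) * (ka - l) / (sg * m) * z0)"
proof -
  have *: "sqrt u = w * sqrt v" if "w \<ge> 0" "u = w^2 * v" for u v w :: real
    using that by (simp add: real_sqrt_mult)
  have w2: "w^2 * (n * k) = sg^2 * l * m \<Longrightarrow> (w * n / (sg * m))^2 = n * l / (m * k)"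
    if "k \<noteq> 0" for w n k
  proof -
    assume "w^2 * (n * k) = sg^2 * l * m"
    then have "w^2 * n = sg^2 * l * m / k" using that by (simp add: field_simps)
    then have "w^2 * n^2 = n * (sg^2 * l * m / k)" by (simp add: power2_eq_square mult.assoc mult.left_commute)
    then show ?thesis
      using sg_pos pos by (simp add: power_divide power_mult_distrib) (simp add: field_simps power2_eq_square)
  qed
  have nz: "al \<noteq> 0" "be \<noteq> 0" "ka \<noteq> 0" "l \<noteq> 0" "m \<noteq> 0" "ka - be \<noteq> 0" "l - al \<noteq> 0" "m - be \<noteq> 0" "ka - m \<noteq> 0"
    using pos be_m m_ka by auto
  have "((al - sg) * (m - al) / (sg * m))^2 = (m - al) * l / (m * (l - al))"
    using w2[OF nz(7), of "al - sg" "m - al"] root_al by (simp add: mult.commute)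
  then have "sqrt ((m - al) / (al * m)) = (al - sg) * (m - al) / (sg * m) * x0"
    unfolding x0_def using nz pos sg_al sg_pos by (intro *) simp_all
  then show "r e1 e2 e3 $ 1 = e1 * ((al - sg) * (m - al) / (sg * m) * x0)"
    by (simp add: impact_def)
  have "((be - sg) * (l - be) / (sg * m))^2 = (l - be) * l / (m * (m - be))"
    using w2[OF nz(8), of "be - sg" "l - be"] root_be by simp
  then have "sqrt (al * (l - be) / (be * m * (ka - be))) = (be - sg) * (l - be) / (sg * m) * y0"
    unfolding y0_def using nz pos be_l sg_pos by (intro *) (simp_all add: mult_ac)
  then show "r e1 e2 e3 $ 2 = e2 * ((be - sg) * (l - be) / (sg * m) * y0)"
    by (simp add: impact_def)
  have "((ka - sg) * (ka - l) / (sg * m))^2 = (ka - l) * l / (m * (ka - m))"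
    using w2[OF nz(9), of "ka - sg" "ka - l"] root_ka by simp
  then have "sqrt (al * (ka - l) / (ka * m * (ka - be))) = (ka - sg) * (ka - l) / (sg * m) * z0"
    unfolding z0_def using nz pos l_ka sg_pos by (intro *) (simp_all add: mult_ac)
  then show "r e1 e2 e3 $ 3 = e3 * ((ka - sg) * (ka - l) / (sg * m) * z0)"
    by (simp add: impact_def)
qed

section \<open>The ellipsoid and the reflection law at the impact points\<close>

lemma impact_in_ellipsoid:
  assumes "e1^2 = 1" "e2^2 = 1" "e3^2 = 1"
  shows "q e1 e2 e3 \<in> ellipsoid (1 / al) (1 / be) (1 / ka)"
proof -
  have "(l - al) / l + al * (m - be) / (l * (ka - be)) + al * (ka - m) / (l * (ka - be)) = 1"
    using pos by (simp add: divide_simps) (simp add: algebra_simps)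
  then show ?thesis
    using pos be_l be_m l_ka m_ka assms by (simp add: ellipsoid_def power_mult_distrib squares)
qed


text \<open>Reflection preserves length, so this is the length of a long chord, from
  \<open>q\<close> to \<open>r\<close>, divided by that of the short chord between two points
  \<open>q\<close>.\<close>

definition rho :: real where
  "rho = (m + sg - al) * (l + sg - al) / (2 * sg * m)"

lemma rho_pos: "0 < rho"
  using pos sg_pos by (simp add: rho_def)

text \<open>Together these give the coefficient \<open>2 / (l + sg - al)\<close> of the reflection,
  the same for all choices of signs.\<close>

lemma normal_products:
  assumes "e1^2 = 1" "e2^2 = 1" "e3^2 = 1"
  defines "n \<equiv> ellipsoid_normal (1 / al) (1 / be) (1 / ka) (q e1 e2 e3)"
  shows "(q e1 e2 e3 - q e1 (- e2) (- e3)) \<bullet> n = 2 * al / l"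
    and "n \<bullet> n = 2 * al * (l + sg - al) / l"
proof -
  have "al * (m - be) / (l * (ka - be)) + al * (ka - m) / (l * (ka - be)) = al / l"
    using pos by (simp add: divide_simps) (simp add: algebra_simps)
  moreover have "(q e1 e2 e3 - q e1 (- e2) (- e3)) \<bullet> n
      = 2 * (al * (m - be) / (l * (ka - be)) + al * (ka - m) / (l * (ka - be)))"
  proof -
    have "(q e1 e2 e3 - q e1 (- e2) (- e3)) \<bullet> n = 2 * (be * e2^2 * y0^2 + ka * e3^2 * z0^2)"
      by (simp add: n_def inner_vec3 power2_eq_square algebra_simps)
    then show ?thesis using pos assms(2,3) by (simp add: squares)
  qed
  ultimately show "(q e1 e2 e3 - q e1 (- e2) (- e3)) \<bullet> n = 2 * al / l"
    by simp
  have "n \<bullet> n = e1^2 * al^2 * x0^2 + e2^2 * be^2 * y0^2 + e3^2 * ka^2 * z0^2"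
    by (simp add: n_def inner_vec3 power2_eq_square mult_ac)
  also have "\<dots> = al * (l - al) / l + be * al * (m - be) / (l * (ka - be))
      + ka * al * (ka - m) / (l * (ka - be))"
    using pos assms unfolding squares by (simp add: power2_eq_square)
  also have "\<dots> = al * (l + be + ka - al - m) / l"
    using pos by (simp add: divide_simps) (simp add: algebra_simps)
  also have "l + be + ka - al - m = 2 * (l + sg - al)" using e1 by simp
  finally show "n \<bullet> n = 2 * al * (l + sg - al) / l" by simp
qed

lemma reflect_impact:
  assumes "e1^2 = 1" "e2^2 = 1" "e3^2 = 1"
  defines "n \<equiv> ellipsoid_normal (1 / al) (1 / be) (1 / ka) (q e1 e2 e3)"
  shows "r (- e1) e2 (- e3) - q e1 e2 e3 = rho *\<^sub>R reflect n (q e1 e2 e3 - q e1 (- e2) (- e3))"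
proof -
  have K: "2 * ((q e1 e2 e3 - q e1 (- e2) (- e3)) \<bullet> n) / (n \<bullet> n) = 2 / (l + sg - al)"
    using normal_products[OF assms(1-3)] pos sg_pos by (simp add: n_def) (simp add: field_simps)
  define K where "K = 2 / (l + sg - al)"
  have rK: "rho * K = (m + sg - al) / (sg * m)"
    using pos sg_pos by (simp add: rho_def K_def)
  \<comment> \<open>Up to a sign and the factor \<open>x0\<close>, \<open>y0\<close> or
    \<open>z0\<close>, the coordinates of the reflection law are the identities \<open>X\<close>,
    \<open>Y\<close> and \<open>Z\<close>; the last two rest on the locale facts \<open>e1\<close>
    and \<open>e2\<close>.\<close>
  have X: "(al - sg) * (m - al) / (sg * m) + 1 = rho * K * al"
    using pos sg_pos by (simp add: rK divide_simps) (simp add: algebra_simps)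
  have Y: "(be - sg) * (l - be) / (sg * m) - 1 = 2 * rho - rho * K * be"
  proof -
    have "(be - sg) * (l - be) - sg * m = (m + sg - al) * (l + sg - al) - (m + sg - al) * be"
      using e1 e2 by algebra
    then show ?thesis
      using pos sg_pos by (simp only: rK) (simp add: rho_def divide_simps)
  qed
  have Z: "(ka - sg) * (ka - l) / (sg * m) + 1 = rho * K * ka - 2 * rho"
  proof -
    have "(ka - sg) * (ka - l) + sg * m = (m + sg - al) * ka - (m + sg - al) * (l + sg - al)"
      using e1 e2 by algebra
    then show ?thesis
      using pos sg_pos by (simp only: rK) (simp add: rho_def divide_simps)
  qed
  show ?thesis
    unfolding reflect_def K K_def[symmetric] vec_eq_iff forall_3
  proof (intro conjI)
    show "(r (- e1) e2 (- e3) - q e1 e2 e3) $ 1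
        = (rho *\<^sub>R (q e1 e2 e3 - q e1 (- e2) (- e3) - K *\<^sub>R n)) $ 1"
      using arg_cong[OF X, of "\<lambda>x. - e1 * x0 * x"]
      by (simp add: n_def algebra_simps)
    show "(r (- e1) e2 (- e3) - q e1 e2 e3) $ 2
        = (rho *\<^sub>R (q e1 e2 e3 - q e1 (- e2) (- e3) - K *\<^sub>R n)) $ 2"
      using arg_cong[OF Y, of "\<lambda>x. e2 * y0 * x"]
      by (simp add: n_def algebra_simps)
    show "(r (- e1) e2 (- e3) - q e1 e2 e3) $ 3
        = (rho *\<^sub>R (q e1 e2 e3 - q e1 (- e2) (- e3) - K *\<^sub>R n)) $ 3"
      using arg_cong[OF Z, of "\<lambda>x. - e3 * z0 * x"]
      by (simp add: n_def algebra_simps)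
  qed
qed

section \<open>Values of the caustic forms along the chords\<close>

abbreviation "form \<equiv> confocal_form (1 / al) (1 / be) (1 / ka)"

lemma inverse_diffs:
  "1 / al - 1 / l = (l - al) / (al * l)" "1 / be - 1 / l = (l - be) / (be * l)"
  "1 / ka - 1 / l = - (ka - l) / (ka * l)"
  using pos by (simp_all add: field_simps)

lemma form_vertex:
  assumes "e1^2 = 1"
  shows "form (1 / l) (q e1 0 0) (q e1 0 0) = 1"
proof -
  have "form (1 / l) (q e1 0 0) (q e1 0 0) = e1^2 * x0^2 / ((l - al) / (al * l))"
    unfolding inverse_diffs[symmetric] by (simp add: confocal_form_def power2_eq_square mult_ac)
  then show ?thesis using pos assms by (simp add: squares)
qed

text \<open>The first coordinate contributes \<open>e1^2\<close>; in the other terms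
  \<open>root_l\<close> replaces \<open>(l - be) * (ka - l)\<close> by
  \<open>sg^2 * m / (l - al)\<close>.\<close>

lemma form_q:
  assumes "e2^2 = 1" "e3^2 = 1"
  shows "e1^2 = 1 \<Longrightarrow> form (1 / l) (q e1 e2 e3) (q e1 e2 e3) = 1 + al * (m - l) * (l - al) / (sg^2 * m)"
    and "form (1 / l) (q 0 e2 e3) (q 0 e2 e3) = al * (m - l) * (l - al) / (sg^2 * m)"
proof -
  have "form (1 / l) (q e1 e2 e3) (q e1 e2 e3)
      = e1^2 + al * ((m - be) / ((ka - be) * (l - be)) - (ka - m) / ((ka - be) * (ka - l)))" for e1
  proof -
    have "form (1 / l) (q e1 e2 e3) (q e1 e2 e3)
      = e1^2 * x0^2 / ((l - al) / (al * l)) + e2^2 * y0^2 / ((l - be) / (be * l))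
       + e3^2 * z0^2 / (- (ka - l) / (ka * l))"
      unfolding inverse_diffs[symmetric] by (simp add: confocal_form_def power2_eq_square mult_ac)
    also have "\<dots> = e1^2 + al * ((m - be) / ((ka - be) * (l - be)) - (ka - m) / ((ka - be) * (ka - l)))"
      using pos be_l l_ka assms unfolding squares by (simp add: divide_simps) (simp add: algebra_simps)
    finally show ?thesis .
  qed
  moreover have "(m - be) / ((ka - be) * (l - be)) - (ka - m) / ((ka - be) * (ka - l))
      = (m - l) * (l - al) / (sg^2 * m)"
  proof -
    have "(m - be) / ((ka - be) * (l - be)) - (ka - m) / ((ka - be) * (ka - l))
       = ((m - be) * (ka - l) - (ka - m) * (l - be)) / ((ka - be) * ((l - be) * (ka - l)))"
      using pos be_l l_ka by (simp add: divide_simps)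
    also have "(m - be) * (ka - l) - (ka - m) * (l - be) = (m - l) * (ka - be)" by algebra
    also have "(m - l) * (ka - be) / ((ka - be) * ((l - be) * (ka - l))) = (m - l) / ((l - be) * (ka - l))"
      using pos by simp
    also have "\<dots> = (m - l) * (l - al) / (sg^2 * m)"
      unfolding root_l[symmetric] using pos by simp
    finally show ?thesis .
  qed
  ultimately show "e1^2 = 1 \<Longrightarrow> form (1 / l) (q e1 e2 e3) (q e1 e2 e3) = 1 + al * (m - l) * (l - al) / (sg^2 * m)"
    and "form (1 / l) (q 0 e2 e3) (q 0 e2 e3) = al * (m - l) * (l - al) / (sg^2 * m)"
    by (simp_all add: mult.assoc)
qed


text \<open>The second and third coordinates cancel because \<open>(0, y0, z0)\<close> is an
  asymptotic direction of this caustic, so the position \<open>t\<close> along the chord drops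
  out.\<close>

lemma form_q_m:
  assumes "e1^2 = 1" "e2^2 = 1" "e3^2 = 1"
  shows "form (1 / m) (q e1 (t * e2) (t * e3)) (q e1 (t * e2) (t * e3)) = m * (l - al) / (l * (m - al))"
    and "form (1 / m) (q d (t * e2) (t * e3)) (q 0 e2 e3) = 0"
proof -
  have *: "form (1 / m) (q e1 (t * e2) (t * e3)) (q d (u * e2) (u * e3))
      = e1 * d * (m * (l - al) / (l * (m - al)))" for e1 t d u
  proof -
    have "form (1 / m) (q e1 (t * e2) (t * e3)) (q d (u * e2) (u * e3))
      = e1 * d * x0^2 / ((m - al) / (al * m)) + t * u * e2^2 * y0^2 / ((m - be) / (be * m))
       + t * u * e3^2 * z0^2 / (- (ka - m) / (ka * m))"
      unfolding four_periodic.inverse_diffs[OF swap, symmetric] by (simp add: confocal_form_def power2_eq_square mult_ac)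
    also have "\<dots> = e1 * d * (m * (l - al) / (l * (m - al)))"
      using pos be_m m_ka assms unfolding squares by (simp add: divide_simps) (simp add: algebra_simps)
    finally show ?thesis .
  qed
  show "form (1 / m) (q e1 (t * e2) (t * e3)) (q e1 (t * e2) (t * e3)) = m * (l - al) / (l * (m - al))"
    using *[of e1 t e1 t] assms by (simp add: power2_eq_square)
  show "form (1 / m) (q d (t * e2) (t * e3)) (q 0 e2 e3) = 0"
    using *[of d t 0 1] by simp
qed

lemma form_r:
  assumes "e1^2 = 1" "e2^2 = 1" "e3^2 = 1"
  shows "form (1 / l) (r e1 e2 e3) (r e1 e2 e3) = 1 + al * (m - l) / (m * (l - al))"
proof -
  have "form (1 / l) (r e1 e2 e3) (r e1 e2 e3) = l * (m - al) / (m * (l - al))"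
    using four_periodic.form_q_m(1)[OF swap, of e1 e2 e3 1] assms by simp
  also have "\<dots> = 1 + al * (m - l) / (m * (l - al))"
    using pos by (simp add: divide_simps) (simp add: algebra_simps)
  finally show ?thesis .
qed

lemma form_q_r:
  assumes "e1^2 = 1" "e2^2 = 1" "e3^2 = 1"
  shows "form (1 / l) (q e1 e2 e3) (r (- e1) e2 (- e3)) = 1 + al * (l - m) / (sg * m)"
proof -
  have "form (1 / l) (q e1 e2 e3) (r (- e1) e2 (- e3))
    = - (e1^2 * x0^2 * ((al - sg) * (m - al) / (sg * m)) / ((l - al) / (al * l)))
      + e2^2 * y0^2 * ((be - sg) * (l - be) / (sg * m)) / ((l - be) / (be * l))
      - e3^2 * z0^2 * ((ka - sg) * (ka - l) / (sg * m)) / (- (ka - l) / (ka * l))"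
    unfolding inverse_diffs[symmetric] by (simp add: confocal_form_def power2_eq_square mult_ac)
  also have "\<dots> = (- (al - sg) * (m - al)
      + al * (((m - be) * (be - sg) + (ka - m) * (ka - sg)) / (ka - be))) / (sg * m)"
    using pos be_l l_ka sg_pos assms unfolding squares
    by (simp add: divide_simps) (simp add: algebra_simps)
  also have "(m - be) * (be - sg) + (ka - m) * (ka - sg) = (ka - be) * (ka + be - sg - m)"
    by algebra
  also have "\<dots> / (ka - be) = ka + be - sg - m" using pos by simp
  also have "- (al - sg) * (m - al) + al * (ka + be - sg - m) = sg * m + al * (l - m)"
    using e1 by algebra
  finally show ?thesis using pos sg_pos by (simp add: add_divide_distrib)
qed

text \<open>The midpoint of the short chord is a vertex of the caustic \<open>1 / l\<close> on the
  x-axis, and the chord is perpendicular to that axis. For \<open>1 / m\<close> the chord has an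
  asymptotic direction and the contact is at infinity.\<close>

lemma line_tangent_short:
  assumes "e1^2 = 1" "e2^2 = 1" "e3^2 = 1"
  shows "line_tangent_to_quadric (1 / al) (1 / be) (1 / ka) (1 / l)
           (q e1 e2 e3) (q e1 (- e2) (- e3) - q e1 e2 e3)"
    and "line_tangent_to_quadric (1 / al) (1 / be) (1 / ka) (1 / m)
           (q e1 e2 e3) (q e1 (- e2) (- e3) - q e1 e2 e3)"
proof -
  have v: "q e1 (- e2) (- e3) - q e1 e2 e3 = (- 2) *\<^sub>R q 0 e2 e3"
    by (simp add: vec_eq_iff forall_3)
  have mid: "q e1 e2 e3 + (1 / 2) *\<^sub>R (- 2) *\<^sub>R q 0 e2 e3 = q e1 0 0"
    by (simp add: vec_eq_iff forall_3)
  note form_vertex[OF assms(1)]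
  moreover have "form (1 / l) (q e1 0 0) (q 0 e2 e3) = 0" by (simp add: confocal_form_def)
  ultimately show "line_tangent_to_quadric (1 / al) (1 / be) (1 / ka) (1 / l)
           (q e1 e2 e3) (q e1 (- e2) (- e3) - q e1 e2 e3)"
    unfolding v line_tangent_to_quadric_def confocal_quadric_def mem_Collect_eq
    by (intro disjI1 exI[of _ "1/2"], unfold mid) (simp add: confocal_form_bilinear)
  show "line_tangent_to_quadric (1 / al) (1 / be) (1 / ka) (1 / m)
           (q e1 e2 e3) (q e1 (- e2) (- e3) - q e1 e2 e3)"
    using form_q_m(2)[OF assms, of 0 1] form_q_m(2)[OF assms, of e1 1]
    unfolding v line_tangent_to_quadric_def by (intro disjI2) (simp add: confocal_form_bilinear)
qed

text \<open>Parameter of the contact with the caustic \<open>1 / l\<close> on a long chord run from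
  \<open>q\<close> to \<open>r\<close>.\<close>

definition tangency :: real where
  "tangency = (l - al) / (l - al + sg)"

text \<open>Put \<open>C = al * (m - l) / (m * (l - al))\<close> and
  \<open>w = (l - al) / sg\<close>. The form minus 1 at the pairs \<open>q, q\<close>, then
  \<open>q, r\<close>, then \<open>r, r\<close> is \<open>C * w^2\<close>, \<open>- C * w\<close>,
  \<open>C\<close>. Along the chord this combines to a multiple of a perfect square, whose double
  zero is the tangency.\<close>

lemma form_long:
  assumes "e1^2 = 1" "e2^2 = 1" "e3^2 = 1"
  defines "p \<equiv> \<lambda>t. (1 - t) *\<^sub>R q e1 e2 e3 + t *\<^sub>R r (- e1) e2 (- e3)"
  shows "form (1 / l) (p t) (p t)
      = 1 + al * (m - l) / (m * (l - al)) * ((1 - t) * ((l - al) / sg) - t)^2"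
    and "form (1 / l) (p t) (r (- e1) e2 (- e3) - q e1 e2 e3)
      = al * (l - m) / (m * (l - al)) * ((l - al) / sg + 1) * ((1 - t) * ((l - al) / sg) - t)"
proof -
  have e': "(- e1)^2 = 1" "(- e3)^2 = 1" using assms by simp_all
  have qq: "form (1 / l) (q e1 e2 e3) (q e1 e2 e3) = 1 + al * (m - l) * (l - al) / (sg^2 * m)"
    using form_q(1) assms by simp
  have rq: "form (1 / l) (r (- e1) e2 (- e3)) (q e1 e2 e3) = 1 + al * (l - m) / (sg * m)"
    using form_q_r[OF assms(1-3)] by (simp add: confocal_form_commute)
  note f = qq rq form_q_r[OF assms(1-3)] form_r[OF e'(1) assms(2) e'(2)]
  show "form (1 / l) (p t) (p t)
      = 1 + al * (m - l) / (m * (l - al)) * ((1 - t) * ((l - al) / sg) - t)^2"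
    using pos sg_pos unfolding p_def confocal_form_bilinear f
    by (simp add: divide_simps) (simp add: algebra_simps power2_eq_square)
  show "form (1 / l) (p t) (r (- e1) e2 (- e3) - q e1 e2 e3)
      = al * (l - m) / (m * (l - al)) * ((l - al) / sg + 1) * ((1 - t) * ((l - al) / sg) - t)"
    using pos sg_pos unfolding p_def confocal_form_bilinear f
    by (simp add: divide_simps) (simp add: algebra_simps power2_eq_square)
qed

lemma tangency_iff: "(1 - t) * ((l - al) / sg) - t = 0 \<longleftrightarrow> t = tangency"
proof -
  have "(1 - t) * ((l - al) / sg) - t = ((l - al) - t * (l - al + sg)) / sg"
    using sg_pos by (simp add: field_simps)
  then have "(1 - t) * ((l - al) / sg) - t = 0 \<longleftrightarrow> t * (l - al + sg) = l - al"
    using sg_pos by auto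
  also have "\<dots> \<longleftrightarrow> t = tangency"
    using pos sg_pos by (simp add: tangency_def field_simps)
  finally show ?thesis .
qed

lemma line_tangent_long:
  assumes "e1^2 = 1" "e2^2 = 1" "e3^2 = 1"
  shows "line_tangent_to_quadric (1 / al) (1 / be) (1 / ka) (1 / l)
           (q e1 e2 e3) (r (- e1) e2 (- e3) - q e1 e2 e3)"
proof -
  have *: "q e1 e2 e3 + tangency *\<^sub>R (r (- e1) e2 (- e3) - q e1 e2 e3)
      = (1 - tangency) *\<^sub>R q e1 e2 e3 + tangency *\<^sub>R r (- e1) e2 (- e3)"
    by (simp add: algebra_simps)
  have t: "(1 - tangency) * ((l - al) / sg) - tangency = 0" by (simp only: tangency_iff)
  show ?thesis
    unfolding line_tangent_to_quadric_def confocal_quadric_def mem_Collect_eq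
    by (intro disjI1 exI[of _ tangency], unfold *, unfold form_long[OF assms] t) simp
qed

lemma long_in_quadric_iff:
  assumes "e1^2 = 1" "e2^2 = 1" "e3^2 = 1" "l \<noteq> m"
  shows "(1 - t) *\<^sub>R q e1 e2 e3 + t *\<^sub>R r (- e1) e2 (- e3)
      \<in> confocal_quadric (1 / al) (1 / be) (1 / ka) (1 / l) \<longleftrightarrow> t = tangency"
  unfolding confocal_quadric_def mem_Collect_eq form_long[OF assms(1-3)] tangency_iff[symmetric]
  using pos assms by simp

text \<open>Along the short chord the excess of \<open>1 / l\<close> is a constant times
  \<open>(1 - 2 * t)^2\<close>, while the form of \<open>1 / m\<close> is constant and different
  from 1. For \<open>l = m\<close> the chord would lie in the quadric.\<close>

lemma short_in_quadric_iff:
  assumes "e1^2 = 1" "e2^2 = 1" "e3^2 = 1" "l \<noteq> m"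
  shows "(1 - t) *\<^sub>R q e1 e2 e3 + t *\<^sub>R q e1 (- e2) (- e3)
      \<in> confocal_quadric (1 / al) (1 / be) (1 / ka) (1 / l) \<longleftrightarrow> t = 1 / 2"
    and "(1 - t) *\<^sub>R q e1 e2 e3 + t *\<^sub>R q e1 (- e2) (- e3)
      \<notin> confocal_quadric (1 / al) (1 / be) (1 / ka) (1 / m)"
proof -
  have p: "(1 - t) *\<^sub>R q e1 e2 e3 + t *\<^sub>R q e1 (- e2) (- e3) = q e1 ((1 - 2 * t) * e2) ((1 - 2 * t) * e3)"
    by (simp add: vec_eq_iff forall_3 algebra_simps)
  have "form (1 / l) (q e1 (u * e2) (u * e3)) (q e1 (u * e2) (u * e3))
      = 1 + u^2 * (al * (m - l) * (l - al) / (sg^2 * m))" for u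
  proof -
    have "form (1 / l) (q e1 (u * e2) (u * e3)) (q e1 (u * e2) (u * e3))
      = form (1 / l) (q e1 0 0) (q e1 0 0) + u^2 * form (1 / l) (q 0 e2 e3) (q 0 e2 e3)"
      by (simp add: confocal_form_def power2_eq_square algebra_simps add_divide_distrib)
    then show ?thesis using assms by (simp add: form_q(2) form_vertex)
  qed
  then show "(1 - t) *\<^sub>R q e1 e2 e3 + t *\<^sub>R q e1 (- e2) (- e3)
      \<in> confocal_quadric (1 / al) (1 / be) (1 / ka) (1 / l) \<longleftrightarrow> t = 1 / 2"
    unfolding p confocal_quadric_def mem_Collect_eq using pos sg_pos assms by auto
  show "(1 - t) *\<^sub>R q e1 e2 e3 + t *\<^sub>R q e1 (- e2) (- e3)
      \<notin> confocal_quadric (1 / al) (1 / be) (1 / ka) (1 / m)"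
    unfolding p confocal_quadric_def mem_Collect_eq form_q_m(1)[OF assms(1-3)]
    using pos assms by (simp add: divide_simps) (simp add: algebra_simps)
qed

text \<open>The half-turn about the x-axis exchanges the first two and the last two impact points.
  So two opposite chords cross the axis, and the other two are images of each other, run through in
  opposite senses.\<close>

definition orbit :: "int \<Rightarrow> real^3" where
  "orbit k = (if k mod 4 = 0 then q 1 1 1 else if k mod 4 = 1 then q 1 (- 1) (- 1)
     else if k mod 4 = 2 then r (- 1) (- 1) 1 else r (- 1) 1 (- 1))"

lemma orbit_add_4: "orbit (k + 4) = orbit k"
  by (simp add: orbit_def)

lemma orbit_mod:
  "orbit (4 * j) = q 1 1 1" "orbit (4 * j + 1) = q 1 (- 1) (- 1)"
  "orbit (4 * j + 2) = r (- 1) (- 1) 1" "orbit (4 * j + 3) = r (- 1) 1 (- 1)"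
  "orbit (4 * j + 4) = q 1 1 1" "orbit (4 * j - 1) = r (- 1) 1 (- 1)"
proof -
  have "(4 * j - 1) mod 4 = 3" by presburger
  then show "orbit (4 * j - 1) = r (- 1) 1 (- 1)" by (simp add: orbit_def)
qed (simp_all add: orbit_def)

lemma orbit_steps:
  obtains "orbit (k - 1) = r (- 1) 1 (- 1)" "orbit k = q 1 1 1" "orbit (k + 1) = q 1 (- 1) (- 1)"
  | "orbit (k - 1) = q 1 1 1" "orbit k = q 1 (- 1) (- 1)" "orbit (k + 1) = r (- 1) (- 1) 1"
  | "orbit (k - 1) = q 1 (- 1) (- 1)" "orbit k = r (- 1) (- 1) 1" "orbit (k + 1) = r (- 1) 1 (- 1)"
  | "orbit (k - 1) = r (- 1) (- 1) 1" "orbit k = r (- 1) 1 (- 1)" "orbit (k + 1) = q 1 1 1"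
proof (cases k rule: mod_4_cases)
  case (1 j)
  then show ?thesis by (intro that(1)) (simp_all only: orbit_mod)
next
  case (2 j)
  then have "k - 1 = 4 * j" "k + 1 = 4 * j + 2" by simp_all
  with 2 show ?thesis by (intro that(2)) (simp_all only: orbit_mod)
next
  case (3 j)
  then have "k - 1 = 4 * j + 1" "k + 1 = 4 * j + 3" by simp_all
  with 3 show ?thesis by (intro that(3)) (simp_all only: orbit_mod)
next
  case (4 j)
  then have "k - 1 = 4 * j + 2" "k + 1 = 4 * j + 4" by simp_all
  with 4 show ?thesis by (intro that(4)) (simp_all only: orbit_mod)
qed

lemma q_distinct:
  "q 1 e2 e3 \<noteq> r (- 1) d2 d3" "q e1 1 e3 \<noteq> q e1 (- 1) d3" "r e1 1 e3 \<noteq> r e1 (- 1) d3"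
proof -
  have "q 1 e2 e3 $ 1 > 0" using sqrt_pos(1) by simp
  moreover have "r (- 1) d2 d3 $ 1 < 0" using four_periodic.sqrt_pos(1)[OF swap] by (simp add: four_periodic.q_nth[OF swap] del: r_nth)
  ultimately show "q 1 e2 e3 \<noteq> r (- 1) d2 d3" by force
  show "q e1 1 e3 \<noteq> q e1 (- 1) d3"
  proof
    assume "q e1 1 e3 = q e1 (- 1) d3"
    then have "q e1 1 e3 $ 2 = q e1 (- 1) d3 $ 2" by simp
    then show False using sqrt_pos(2) by simp
  qed
  show "r e1 1 e3 \<noteq> r e1 (- 1) d3"
  proof
    assume "r e1 1 e3 = r e1 (- 1) d3"
    then have "r e1 1 e3 $ 2 = r e1 (- 1) d3 $ 2" by simp
    then show False using four_periodic.sqrt_pos(2)[OF swap] by (simp add: four_periodic.q_nth[OF swap] del: r_nth)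
  qed
qed

lemma billiard_trajectory_orbit: "billiard_trajectory (1 / al) (1 / be) (1 / ka) orbit"
  unfolding billiard_trajectory_def chord_direction_def
proof
  fix k :: int
  have k: "k - 1 + 1 = k" by simp
  \<comment> \<open>Corners at \<open>q\<close> use \<open>law\<close>, those at \<open>r\<close>
    the swapped version; in both cases the second form applies when the corner is left along its
    short chord.\<close>
  note law = reflection_law[OF reflect_impact rho_pos]
  note sw_law = reflection_law[OF four_periodic.reflect_impact[OF swap] four_periodic.rho_pos[OF swap]]
  show "orbit k \<in> ellipsoid (1 / al) (1 / be) (1 / ka) \<and> orbit (k + 1) \<noteq> orbit k \<and>
      sgn (orbit (k + 1) - orbit k) = reflect (ellipsoid_normal (1 / al) (1 / be) (1 / ka) (orbit k))
        (sgn (orbit (k - 1 + 1) - orbit (k - 1)))"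
    unfolding k
  proof (cases k rule: orbit_steps)
    case 1
    then show "orbit k \<in> ellipsoid (1 / al) (1 / be) (1 / ka) \<and> orbit (k + 1) \<noteq> orbit k \<and>
      sgn (orbit (k + 1) - orbit k) = reflect (ellipsoid_normal (1 / al) (1 / be) (1 / ka) (orbit k))
        (sgn (orbit k - orbit (k - 1)))"
      using impact_in_ellipsoid[of 1 1 1] law(2)[of 1 1 1] q_distinct(2)[of 1 1 "- 1"] by auto
  next
    case 2
    then show "orbit k \<in> ellipsoid (1 / al) (1 / be) (1 / ka) \<and> orbit (k + 1) \<noteq> orbit k \<and>
      sgn (orbit (k + 1) - orbit k) = reflect (ellipsoid_normal (1 / al) (1 / be) (1 / ka) (orbit k))
        (sgn (orbit k - orbit (k - 1)))"
      using impact_in_ellipsoid[of 1 "- 1" "- 1"] law(1)[of 1 "- 1" "- 1"]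
        q_distinct(1)[of "- 1" "- 1" "- 1" 1] by auto
  next
    case 3
    then show "orbit k \<in> ellipsoid (1 / al) (1 / be) (1 / ka) \<and> orbit (k + 1) \<noteq> orbit k \<and>
      sgn (orbit (k + 1) - orbit k) = reflect (ellipsoid_normal (1 / al) (1 / be) (1 / ka) (orbit k))
        (sgn (orbit k - orbit (k - 1)))"
      using four_periodic.impact_in_ellipsoid[OF swap, of "- 1" "- 1" 1] sw_law(2)[of "- 1" "- 1" 1]
        q_distinct(3)[of "- 1" "- 1" 1] by auto
  next
    case 4
    then show "orbit k \<in> ellipsoid (1 / al) (1 / be) (1 / ka) \<and> orbit (k + 1) \<noteq> orbit k \<and>
      sgn (orbit (k + 1) - orbit k) = reflect (ellipsoid_normal (1 / al) (1 / be) (1 / ka) (orbit k))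
        (sgn (orbit k - orbit (k - 1)))"
      using four_periodic.impact_in_ellipsoid[OF swap, of "- 1" 1 "- 1"] sw_law(1)[of "- 1" 1 "- 1"]
        q_distinct(1)[of 1 1 1 "- 1"] by auto
  qed
qed

lemma periodic_orbit: "periodic_trajectory orbit"
  unfolding periodic_trajectory_def by (intro exI[of _ 4]) (simp add: orbit_add_4)

lemma trajectory_period_orbit: "trajectory_period orbit = 4"
  unfolding trajectory_period_def
proof (rule Least_equality)
  show "4 > (0::nat) \<and> (\<forall>k. orbit (k + int 4) = orbit k)" by (simp add: orbit_add_4)
next
  fix n :: nat assume n: "n > 0 \<and> (\<forall>k. orbit (k + int n) = orbit k)"
  then have "orbit (int n) = orbit 0" by (metis add_0)
  then have "\<not> (n = 1 \<or> n = 2 \<or> n = 3)"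
    using q_distinct(1)[of 1 1 "- 1" 1] q_distinct(1)[of 1 1 1 "- 1"] q_distinct(2)[of 1 1 "- 1"]
    by (auto simp: orbit_def)
  then show "4 \<le> n" using n by linarith
qed

lemma line_tangent_orbit:
  "line_tangent_to_quadric (1 / al) (1 / be) (1 / ka) (1 / l) (orbit k) (orbit (k + 1) - orbit k)"
  "line_tangent_to_quadric (1 / al) (1 / be) (1 / ka) (1 / m) (orbit k) (orbit (k + 1) - orbit k)"
proof -
  note T = line_tangent_short[of 1 1 1] four_periodic.line_tangent_short[OF swap, of "- 1" "- 1" 1]
    line_tangent_long[of 1 "- 1" "- 1"] line_tangent_reverse[OF line_tangent_long[of 1 1 1]]
    four_periodic.line_tangent_long[OF swap, of "- 1" 1 "- 1"] line_tangent_reverse[OF four_periodic.line_tangent_long[OF swap, of "- 1" "- 1" 1]]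
  show "line_tangent_to_quadric (1 / al) (1 / be) (1 / ka) (1 / l) (orbit k) (orbit (k + 1) - orbit k)"
    by (cases k rule: orbit_steps) (use T in auto)
  show "line_tangent_to_quadric (1 / al) (1 / be) (1 / ka) (1 / m) (orbit k) (orbit (k + 1) - orbit k)"
    by (cases k rule: orbit_steps) (use T in auto)
qed

section \<open>Contact times with the caustics and the winding numbers\<close>

lemma orbit_path_in_quadric:
  assumes "0 \<le> t" "t < 1" "l \<noteq> m"
  shows "trajectory_path orbit (4 * real_of_int j + t) \<in> confocal_quadric (1 / al) (1 / be) (1 / ka) (1 / l)
      \<longleftrightarrow> t = 1 / 2"
    and "trajectory_path orbit (4 * real_of_int j + 1 + t) \<in> confocal_quadric (1 / al) (1 / be) (1 / ka) (1 / l)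
      \<longleftrightarrow> t = tangency"
    and "trajectory_path orbit (4 * real_of_int j + 2 + t) \<notin> confocal_quadric (1 / al) (1 / be) (1 / ka) (1 / l)"
    and "trajectory_path orbit (4 * real_of_int j + 3 + t) \<in> confocal_quadric (1 / al) (1 / be) (1 / ka) (1 / l)
      \<longleftrightarrow> t = 1 - tangency"
    and "trajectory_path orbit (4 * real_of_int j + 1 + t) \<in> confocal_quadric (1 / al) (1 / be) (1 / ka) (1 / m)
      \<longleftrightarrow> t = 1 - four_periodic.tangency al sg m"
    and "trajectory_path orbit (4 * real_of_int j + 2 + t) \<in> confocal_quadric (1 / al) (1 / be) (1 / ka) (1 / m)
      \<longleftrightarrow> t = 1 / 2"
    and "trajectory_path orbit (4 * real_of_int j + 3 + t) \<in> confocal_quadric (1 / al) (1 / be) (1 / ka) (1 / m)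
      \<longleftrightarrow> t = four_periodic.tangency al sg m"
proof -
  note seg = trajectory_path_segment[OF assms(1,2), of orbit]
  have p: "trajectory_path orbit (4 * real_of_int j + t) = (1 - t) *\<^sub>R q 1 1 1 + t *\<^sub>R q 1 (- 1) (- 1)"
    "trajectory_path orbit (4 * real_of_int j + 1 + t) = (1 - t) *\<^sub>R q 1 (- 1) (- 1) + t *\<^sub>R r (- 1) (- 1) 1"
    "trajectory_path orbit (4 * real_of_int j + 2 + t) = (1 - t) *\<^sub>R r (- 1) (- 1) 1 + t *\<^sub>R r (- 1) 1 (- 1)"
    "trajectory_path orbit (4 * real_of_int j + 3 + t) = (1 - t) *\<^sub>R r (- 1) 1 (- 1) + t *\<^sub>R q 1 1 1"
    using seg[of "4 * j"] seg[of "4 * j + 1"] seg[of "4 * j + 2"] seg[of "4 * j + 3"] orbit_mod[of j]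
    by (simp_all add: add.assoc)
  have eq: "1 - t = x \<longleftrightarrow> t = 1 - x" for x by auto
  note L = long_in_quadric_iff[of _ _ _ t] long_in_quadric_iff[of _ _ _ "1 - t"]
    four_periodic.long_in_quadric_iff[OF swap, of _ _ _ t] four_periodic.long_in_quadric_iff[OF swap, of _ _ _ "1 - t"]
  show "trajectory_path orbit (4 * real_of_int j + t) \<in> confocal_quadric (1 / al) (1 / be) (1 / ka) (1 / l)
      \<longleftrightarrow> t = 1 / 2"
    using short_in_quadric_iff(1)[of 1 1 1 t] assms unfolding p by simp
  show "trajectory_path orbit (4 * real_of_int j + 1 + t) \<in> confocal_quadric (1 / al) (1 / be) (1 / ka) (1 / l)
      \<longleftrightarrow> t = tangency"
    using L(1)[of 1 "- 1" "- 1"] assms unfolding p by simp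
  show "trajectory_path orbit (4 * real_of_int j + 2 + t) \<notin> confocal_quadric (1 / al) (1 / be) (1 / ka) (1 / l)"
    using four_periodic.short_in_quadric_iff(2)[OF swap, of "- 1" "- 1" 1 t] assms unfolding p by simp
  show "trajectory_path orbit (4 * real_of_int j + 3 + t) \<in> confocal_quadric (1 / al) (1 / be) (1 / ka) (1 / l)
      \<longleftrightarrow> t = 1 - tangency"
    using L(2)[of 1 1 1, unfolded eq] assms unfolding p by (simp add: add.commute)
  show "trajectory_path orbit (4 * real_of_int j + 1 + t) \<in> confocal_quadric (1 / al) (1 / be) (1 / ka) (1 / m)
      \<longleftrightarrow> t = 1 - four_periodic.tangency al sg m"
    using L(4)[of "- 1" "- 1" 1, unfolded eq] assms unfolding p by (simp add: add.commute)
  show "trajectory_path orbit (4 * real_of_int j + 2 + t) \<in> confocal_quadric (1 / al) (1 / be) (1 / ka) (1 / m)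
      \<longleftrightarrow> t = 1 / 2"
    using four_periodic.short_in_quadric_iff(1)[OF swap, of "- 1" "- 1" 1 t] assms unfolding p by simp
  show "trajectory_path orbit (4 * real_of_int j + 3 + t) \<in> confocal_quadric (1 / al) (1 / be) (1 / ka) (1 / m)
      \<longleftrightarrow> t = four_periodic.tangency al sg m"
    using L(3)[of "- 1" 1 "- 1"] assms unfolding p by simp
qed

lemma tangency_bounds: "0 < tangency" "tangency < 1"
  using pos sg_pos by (simp_all add: tangency_def)

text \<open>On a long chord from \<open>q\<close> to \<open>r\<close> the caustic
  \<open>1 / m\<close> is touched before \<open>1 / l\<close>. Cleared of denominators this reads
  \<open>sg^2 < (l - al) * (m - al)\<close>, which follows from \<open>root_al\<close> and
  \<open>(al - sg)^2 < l * m\<close>.\<close>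

lemma tangency_sum: "1 < tangency + four_periodic.tangency al sg m"
proof -
  have "(al - sg)^2 * sg^2 < sg^2 * (l * m)"
  proof -
    have "(al - sg)^2 < al^2" using sg_pos sg_al by (intro power_strict_mono) auto
    also have "al^2 < l * m" using pos by (simp add: power2_eq_square mult_strict_mono)
    finally show ?thesis using sg_pos by simp
  qed
  also have "\<dots> = (al - sg)^2 * ((l - al) * (m - al))" using root_al by simp
  finally have "sg^2 < (l - al) * (m - al)" by (rule mult_left_less_imp_less) simp
  then show ?thesis
    using pos sg_pos unfolding tangency_def four_periodic.tangency_def[OF swap]
    by (simp add: add_frac_eq less_divide_eq) (simp add: algebra_simps power2_eq_square)
qed

lemma caustic_hits:
  assumes "l \<noteq> m"
  shows "trajectory_path orbit t \<in> confocal_quadric (1 / al) (1 / be) (1 / ka) (1 / l) \<longleftrightarrow>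
    (\<exists>j::int. t = 4 * of_int j + 1 / 2 \<or> t = 4 * of_int j + 1 + tangency \<or> t = 4 * of_int j + 4 - tangency)"
    (is "?L \<longleftrightarrow> ?R")
proof
  assume ?L
  have t: "t = real_of_int \<lfloor>t\<rfloor> + frac t" by (simp add: frac_def)
  note f = frac_ge_0[of t] frac_lt_1[of t] assms
  show ?R
  proof (cases "\<lfloor>t\<rfloor>" rule: mod_4_cases)
    case (1 j)
    then have "t = 4 * of_int j + frac t" using t by simp
    with orbit_path_in_quadric(1)[OF f, of j] \<open>?L\<close> show ?thesis by metis
  next
    case (2 j)
    then have "t = 4 * of_int j + 1 + frac t" using t by simp
    with orbit_path_in_quadric(2)[OF f, of j] \<open>?L\<close> show ?thesis by metis
  next
    case (3 j)
    then have "t = 4 * of_int j + 2 + frac t" using t by simp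
    with orbit_path_in_quadric(3)[OF f, of j] \<open>?L\<close> show ?thesis by metis
  next
    \<comment> \<open>The last chord runs from \<open>r\<close> to \<open>q\<close>, so its contact
      parameter is \<open>1 - tangency\<close>.\<close>
    case (4 j)
    then have *: "t = 4 * of_int j + 3 + frac t" using t by simp
    with orbit_path_in_quadric(4)[OF f, of j] \<open>?L\<close> have "frac t = 1 - tangency" by metis
    with * have "t = 4 * of_int j + 4 - tangency" by simp
    then show ?thesis by blast
  qed
next
  assume ?R
  then obtain j :: int where "t = 4 * of_int j + 1 / 2 \<or> t = 4 * of_int j + 1 + tangency
      \<or> t = 4 * of_int j + 4 - tangency" by blast
  then have "t = 4 * of_int j + 1 / 2 \<or> t = 4 * of_int j + 1 + tangency
      \<or> t = 4 * of_int j + 3 + (1 - tangency)" by auto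
  then show ?L
    using orbit_path_in_quadric(1)[of "1 / 2" j] orbit_path_in_quadric(2)[of tangency j]
      orbit_path_in_quadric(4)[of "1 - tangency" j] tangency_bounds assms by auto
qed

lemma elliptic_period_orbit:
  assumes "m < l"
  shows "elliptic_period (1 / al) (1 / be) (1 / ka) (1 / l) (1 / m) orbit = 4"
proof -
  note ord = order_inverse[OF assms]
  define f where "f = (\<lambda>t. elliptic_coord (1 / al) (1 / be) (1 / ka) 1 (trajectory_path orbit t))"
  have lo: "f t = 1 / l \<longleftrightarrow> trajectory_path orbit t \<in> confocal_quadric (1 / al) (1 / be) (1 / ka) (1 / l)" for t
    unfolding f_def using ord by (intro elliptic_coord_1_eq_iff) linarith+
  have hi: "f t = 1 / m \<longleftrightarrow> trajectory_path orbit t \<in> confocal_quadric (1 / al) (1 / be) (1 / ka) (1 / m)" for t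
    unfolding f_def using ord by (intro elliptic_coord_1_eq_iff) linarith+
  have "complete_oscillations f (1 / l) (1 / m) 4 = 3"
  proof (rule complete_oscillations_eq_3)
    show "0 < 1 - four_periodic.tangency al sg m" "1 - four_periodic.tangency al sg m < tangency" "tangency < 1"
      using tangency_bounds four_periodic.tangency_bounds[OF swap] tangency_sum by auto
    show "f t = 1 / l \<longleftrightarrow> (\<exists>j::int. t = 4 * of_int j + 1 / 2 \<or> t = 4 * of_int j + 1 + tangency
        \<or> t = 4 * of_int j + 4 - tangency)" for t
      unfolding lo by (rule caustic_hits) (use assms in simp)
    show "f (1 + (1 - four_periodic.tangency al sg m)) = 1 / m" "f (5 / 2) = 1 / m" "f (4 - (1 - four_periodic.tangency al sg m)) = 1 / m"
      using orbit_path_in_quadric(5)[of "1 - four_periodic.tangency al sg m" 0] orbit_path_in_quadric(6)[of "1 / 2" 0]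
        orbit_path_in_quadric(7)[of "four_periodic.tangency al sg m" 0] four_periodic.tangency_bounds[OF swap] assms
      unfolding hi by simp_all
  qed
  then have w1: "winding_number_at (1 / al) (1 / be) (1 / ka) (1 / l) (1 / m) orbit 1 = 3"
    using cseq_H1H1[OF ord] by (simp add: winding_number_at_def trajectory_period_orbit f_def)
  have w0: "winding_number_at (1 / al) (1 / be) (1 / ka) (1 / l) (1 / m) orbit 0 = 4"
    by (simp add: winding_number_at_def trajectory_period_orbit)
  \<comment> \<open>A common divisor of the first two winding numbers divides
    \<open>4 - 3\<close>.\<close>
  have "Gcd {4, 3, w} = 1" for w :: nat
  proof -
    have "Gcd {4, 3, w} dvd 4 - 3" by (intro dvd_diff_nat Gcd_dvd) auto
    then show ?thesis by simp
  qed
  then show ?thesis unfolding elliptic_period_def w0 w1 by simp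
qed

lemma periodic_H1H1_orbit:
  assumes "m < l"
  shows "periodic_H1H1_trajectory (1 / al) (1 / be) (1 / ka) 4 [0, 0, 1] orbit (1 / l) (1 / m)"
  unfolding periodic_H1H1_trajectory_def nonsingular_with_caustics_def caustic_type_H1H1_def
  using order_inverse[OF assms] billiard_trajectory_orbit periodic_orbit line_tangent_orbit
    elliptic_period_orbit[OF assms] has_signature[OF assms] by auto

end

section \<open>Existence of the trajectories and their caustic parameters\<close>

definition caustic_cubic :: "real \<Rightarrow> real \<Rightarrow> real \<Rightarrow> real poly" where
  "caustic_cubic a b c = [:- 4 * a * b * c, 3 * (a * b + a * c + b * c), - 2 * (a + b + c), 1:]"

text \<open>The cubic is negative, positive, negative at \<open>c\<close>, \<open>b\<close>,
  \<open>a\<close> and positive further right, which gives a root in each of the three intervals. A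
  second root beyond \<open>a\<close> would be a fourth one.\<close>

lemma caustic_cubic_root:
  assumes "a > b" "b > c" "c > 0"
  shows "\<exists>!d. d > a \<and> poly (caustic_cubic a b c) d = 0"
proof -
  define p where "p = caustic_cubic a b c"
  have p: "poly p t = t^3 - 2 * (a + b + c) * t^2 + 3 * (a * b + a * c + b * c) * t - 4 * a * b * c" for t
    unfolding p_def caustic_cubic_def by simp algebra
  have "poly p a = - (a * (a - b) * (a - c))" unfolding p by algebra
  also have "\<dots> < 0" using assms by simp
  finally have pa: "poly p a < 0" .
  have "poly p b = b * (a - b) * (b - c)" unfolding p by algebra
  also have "\<dots> > 0" using assms by simp
  finally have pb: "poly p b > 0" .
  have "poly p c = - (c * (a - c) * (b - c))" unfolding p by algebra
  also have "\<dots> < 0" using assms by simp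
  finally have pc: "poly p c < 0" .
  have "\<exists>t>a. poly p t > 0"
  proof (intro exI conjI)
    \<comment> \<open>This value cancels the cubic term against the quadratic one.\<close>
    let ?t = "2 * (a + b + c)"
    show "?t > a" using assms by simp
    have "poly p ?t = 2 * (3 * (a * b + a * c + b * c) * (a + b + c) - 2 * a * b * c)" unfolding p by algebra
    also have "3 * (a * b + a * c + b * c) * (a + b + c) - 2 * a * b * c
      = 3 * (a^2 * b + a^2 * c + a * b^2 + b^2 * c + a * c^2 + b * c^2) + 7 * a * b * c" by algebra
    also have "2 * \<dots> > 0" using assms by (intro mult_pos_pos add_pos_pos) simp_all
    finally show "poly p ?t > 0" .
  qed
  then obtain t where "t > a" "poly p t > 0" by blast
  then obtain d where d: "d > a" "poly p d = 0" using poly_IVT_pos[OF _ pa] by blast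
  obtain r1 where r1: "c < r1" "r1 < b" "poly p r1 = 0" using poly_IVT_pos[OF _ pc pb] assms by blast
  obtain r2 where r2: "b < r2" "r2 < a" "poly p r2 = 0" using poly_IVT_neg[OF _ pb pa] assms by blast
  have "p \<noteq> 0" "degree p = 3" by (simp_all add: p_def caustic_cubic_def)
  have "d' = d" if d': "d' > a" "poly p d' = 0" for d'
  proof (rule ccontr)
    assume "d' \<noteq> d"
    then have "card {r1, r2, d, d'} = 4" using r1 r2 d d' by auto
    moreover have "card {r1, r2, d, d'} \<le> card {t. poly p t = 0}"
      using r1 r2 d d' \<open>p \<noteq> 0\<close> by (intro card_mono poly_roots_finite) auto
    ultimately show False using card_poly_roots_bound[OF \<open>p \<noteq> 0\<close>] \<open>degree p = 3\<close> by simp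
  qed
  then show ?thesis using d unfolding p_def by blast
qed

text \<open>The factor \<open>- a * b * c * d^3\<close> turns the critical equation of the quartic
  at \<open>1 / d\<close> into the cubic, so \<open>d\<close> is the reciprocal of the double zero
  \<open>sg\<close>.\<close>

lemma caustic_cubic_root_iff:
  fixes a b c d :: real
  assumes "a \<noteq> 0" "b \<noteq> 0" "c \<noteq> 0" "d \<noteq> 0"
  shows "poly (caustic_cubic a b c) d = 0 \<longleftrightarrow>
    4 * (1 / d)^3 - 3 * (1 / a + 1 / b + 1 / c) * (1 / d)^2
      + 2 * (1 / a * (1 / b) + 1 / a * (1 / c) + 1 / b * (1 / c)) * (1 / d) - 1 / a * (1 / b) * (1 / c) = 0"
    (is "?p = 0 \<longleftrightarrow> ?q = 0")
proof -
  define A B C D where "A = 1 / a" and "B = 1 / b" and "C = 1 / c" and "D = 1 / d"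
  have inv: "a * A = 1" "b * B = 1" "c * C = 1" "d * D = 1"
    using assms by (simp_all add: A_def B_def C_def D_def)
  have "?p = - (a * b * c * d^3)
      * (4 * D^3 - 3 * (A + B + C) * D^2 + 2 * (A * B + A * C + B * C) * D - A * B * C)"
    unfolding caustic_cubic_def using inv by simp algebra
  then show ?thesis unfolding A_def B_def C_def D_def using assms by simp
qed

lemma periodic_H1H1_imp_four_periodic:
  assumes "a > b" "b > c" "c > 0" and traj: "periodic_H1H1_trajectory a b c 4 [0, 0, 1] q l1 l2"
  obtains sg where "four_periodic (1 / a) (1 / b) (1 / c) sg (1 / l1) (1 / l2)"
    and "0 < l1" "l1 < l2" "1 / sg > a" "poly (caustic_cubic a b c) (1 / sg) = 0"
proof -
  have o: "c < l1" "l1 < l2" "l2 < b" and "has_signature a b c l1 l2 4 [0, 0, 1]"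
    using traj by (auto simp: periodic_H1H1_trajectory_def caustic_type_H1H1_def)
  then obtain sg where fp: "four_periodic (1 / a) (1 / b) (1 / c) sg (1 / l1) (1 / l2)"
    using signature_imp_four_periodic[of c l1 l2 b a] assms by blast
  have "sg > 0" by (rule four_periodic.sg_pos[OF fp])
  then have "1 / sg > a" using four_periodic.sg_al[OF fp] assms by (simp add: field_simps)
  moreover have "poly (caustic_cubic a b c) (1 / sg) = 0"
    using four_periodic.critical[OF fp] caustic_cubic_root_iff[of a b c "1 / sg"] assms \<open>sg > 0\<close> by simp
  ultimately show ?thesis using that fp o assms by force
qed

lemma ex_periodic_H1H1_iff:
  assumes "a > b" "b > c" "c > 0"
  shows "(\<exists>q l1 l2. periodic_H1H1_trajectory a b c 4 [0, 0, 1] q l1 l2) \<longleftrightarrow> c < a * b / (a + b)"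
proof -
  have bound: "1 / a + 1 / b < 1 / c \<longleftrightarrow> c < a * b / (a + b)"
    using assms by (simp add: field_simps)
  show ?thesis
  proof
    assume "\<exists>q l1 l2. periodic_H1H1_trajectory a b c 4 [0, 0, 1] q l1 l2"
    then obtain sg l1 l2 where fp: "four_periodic (1 / a) (1 / b) (1 / c) sg (1 / l1) (1 / l2)"
      and "0 < l1" "l1 < l2" using periodic_H1H1_imp_four_periodic[OF assms] by metis
    then have "1 / l1 \<noteq> 1 / l2" by simp
    then show "c < a * b / (a + b)" using four_periodic.longest_axis_bound[OF fp] bound by simp
  next
    assume "c < a * b / (a + b)"
    then have h: "1 / a + 1 / b < 1 / c" using bound by simp
    obtain d where d: "d > a" "poly (caustic_cubic a b c) d = 0" using caustic_cubic_root[OF assms] by blast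
    have "\<exists>l m. m < l \<and> four_periodic (1 / a) (1 / b) (1 / c) (1 / d) l m"
    proof (rule four_periodic_exists)
      show "4 * (1 / d)^3 - 3 * (1 / a + 1 / b + 1 / c) * (1 / d)^2
        + 2 * (1 / a * (1 / b) + 1 / a * (1 / c) + 1 / b * (1 / c)) * (1 / d) - 1 / a * (1 / b) * (1 / c) = 0"
        using d assms caustic_cubic_root_iff[of a b c d] by simp
    qed (use h d assms in \<open>simp_all add: divide_strict_left_mono\<close>)
    then obtain l m where "m < l" "four_periodic (1 / a) (1 / b) (1 / c) (1 / d) l m" by blast
    from four_periodic.periodic_H1H1_orbit[OF this(2,1)]
    show "\<exists>q l1 l2. periodic_H1H1_trajectory a b c 4 [0, 0, 1] q l1 l2" by auto
  qed
qed

text \<open>By \<open>e1\<close> and \<open>e2\<close>, \<open>s1\<close> and \<open>s2\<close> are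
  the first two power sums of \<open>1 / l1\<close> and \<open>1 / l2\<close>. Then
  \<open>(s1^2 - s2) / 2\<close> is their product, and the quadratic factors as
  \<open>(1 - t / l1) * (1 - t / l2)\<close>.\<close>

lemma caustic_parameters:
  assumes "a > b" "b > c" "c > 0" and traj: "periodic_H1H1_trajectory a b c 4 [0, 0, 1] q l1 l2"
    and d: "d > a" "poly (caustic_cubic a b c) d = 0"
    and s1: "s1 = 1 / a + 1 / b + 1 / c - 2 / d"
    and s2: "s2 = 1 / a^2 + 1 / b^2 + 1 / c^2 - 2 / d^2"
  shows "{t. poly [:1, - s1, (s1^2 - s2) / 2:] t = 0} = {l1, l2}"
proof -
  obtain sg where fp: "four_periodic (1 / a) (1 / b) (1 / c) sg (1 / l1) (1 / l2)"
    and l: "0 < l1" "l1 < l2" and "1 / sg > a" "poly (caustic_cubic a b c) (1 / sg) = 0"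
    using periodic_H1H1_imp_four_periodic[OF assms(1-4)] .
  then have "d = 1 / sg" using caustic_cubic_root[OF assms(1-3)] d by blast
  note e1 = four_periodic.e1[OF fp] and e2 = four_periodic.e2[OF fp]
  have s1': "s1 = 1 / l1 + 1 / l2" using e1 s1 \<open>d = 1 / sg\<close> by simp
  have "s2 = (1 / a + 1 / b + 1 / c)^2 - 2 * (1 / a * (1 / b) + 1 / a * (1 / c) + 1 / b * (1 / c)) - 2 * sg^2"
    using s2 \<open>d = 1 / sg\<close> by (simp add: power2_eq_square algebra_simps)
  also have "\<dots> = (1 / l1)^2 + (1 / l2)^2" unfolding e1 e2 by algebra
  finally have s2': "(s1^2 - s2) / 2 = 1 / l1 * (1 / l2)" unfolding s1' by (simp add: power2_eq_square algebra_simps)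
  have "poly [:1, - s1, (s1^2 - s2) / 2:] t = (1 - t / l1) * (1 - t / l2)" for t
    unfolding s2' unfolding s1' by (simp add: algebra_simps)
  then show ?thesis using l by auto
qed

theorem proposition20:
  fixes a b c :: real and cubic :: "real poly"
  assumes "a > b" "b > c" "c > 0"
    and "cubic = [:- 4 * a * b * c, 3 * (a * b + a * c + b * c), - 2 * (a + b + c), 1:]"
  shows "((\<exists>q l1 l2. periodic_H1H1_trajectory a b c 4 [0, 0, 1] q l1 l2) \<longleftrightarrow> c < a * b / (a + b))
       \<and> (\<exists>!d. d > a \<and> poly cubic d = 0)
       \<and> (\<forall>q l1 l2 d s1 s2.
            periodic_H1H1_trajectory a b c 4 [0, 0, 1] q l1 l2 \<and> d > a \<and> poly cubic d = 0 \<and>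
            s1 = 1 / a + 1 / b + 1 / c - 2 / d \<and>
            s2 = 1 / a^2 + 1 / b^2 + 1 / c^2 - 2 / d^2
            \<longrightarrow> {t. poly [:1, - s1, (s1^2 - s2) / 2:] t = 0} = {l1, l2})"
proof -
  have "cubic = caustic_cubic a b c" using assms(4) by (simp only: caustic_cubic_def)
  then show ?thesis
    using ex_periodic_H1H1_iff[OF assms(1-3)] caustic_cubic_root[OF assms(1-3)]
      caustic_parameters[OF assms(1-3)] by blast
qed

end
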